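(* Let $C: f=0$ be a reduced plane curve of degree $d\geq 3$ in $\mathbb{P}^2$ of type $(d,r,m)$ with $m>3$, and suppose $\Delta m:=(2r-d+3)-m=2$. Then, with $\epsilon_1,\ldots,\epsilon_{m-2}$ as in the context, one of the following holds: (1) $\epsilon_{m-2}=3$, $\epsilon_j=1$ for $1\leq j\leq m-3$, and $\tau(C)=\frac{d(d-1)}{2}-3+r(d-r-2)$; or (2) $\epsilon_{m-2}=\epsilon_{m-3}=2$, $\epsilon_j=1$ for $1\leq j\leq m-4$, and $\tau(C)=\frac{d(d-1)}{2}-2+r(d-r-2)$.
   Context: Let $S=\mathbb{C}[x,y,z]$, let $f\in S$ be a reduced homogeneous polynomial of degree $d\geq 3$ defining $C$, and assume $C$ is not a union of $d$ lines through one point. Let $J_f=(f_x,f_y,f_z)$ and $M(f)=S/J_f$. Let $D_0(f)=\{(a,b,c)\in S^3: af_x+bf_y+cf_z=0\}$. The curve is of type $(d,r,m)$ if $D_0(f)$ is minimally generated by $m$ homogeneous elements all of degree $r$. When $m\geq 3$, the minimal graded free resolution of $M(f)$ has the form $$0\to \bigoplus_{i=1}^{m-2}S(-e_i)\to \bigoplus_{j=1}^m S(1-d-r)\to S^3(1-d)\to S,$$ with $e_1\leq\cdots\leq e_{m-2}$, and one writes $e_j=d+r-1+\epsilon_j$ with integers $\epsilon_j\geq 1$. The total Tjurina number $\tau(C)$ is the degree of $J_f$, i.e. the sum of the Tjurina numbers of the singular points of $C$. *)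

theory Defs
  imports Complex_Main "HOL-Library.Poly_Mapping" "HOL-Library.Product_Plus"
    "HOL-Library.Function_Algebras"
begin

type_synonym mono3 = "nat \<times> nat \<times> nat"
type_synonym poly3 = "mono3 \<Rightarrow>\<^sub>0 complex"

definition var_x :: poly3 where "var_x = Poly_Mapping.single (1,0,0) 1"
definition var_y :: poly3 where "var_y = Poly_Mapping.single (0,1,0) 1"
definition var_z :: poly3 where "var_z = Poly_Mapping.single (0,0,1) 1"

definition mdeg :: "mono3 \<Rightarrow> nat" where
  "mdeg m = fst m + fst (snd m) + snd (snd m)"

text \<open>p is homogeneous of degree k (the zero polynomial is homogeneous of every degree).\<close>
definition homog :: "nat \<Rightarrow> poly3 \<Rightarrow> bool" where
  "homog k p \<longleftrightarrow> (\<forall>m\<in>Poly_Mapping.keys p. mdeg m = k)"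

definition cscale :: "complex \<Rightarrow> poly3 \<Rightarrow> poly3" where
  "cscale c p = Poly_Mapping.single (0,0,0) c * p"

definition dx :: "poly3 \<Rightarrow> poly3" where
  "dx p = (\<Sum>m\<in>Poly_Mapping.keys p. case m of (a,b,c) \<Rightarrow>
      Poly_Mapping.single (a - 1, b, c) (of_nat a * Poly_Mapping.lookup p m))"
definition dy :: "poly3 \<Rightarrow> poly3" where
  "dy p = (\<Sum>m\<in>Poly_Mapping.keys p. case m of (a,b,c) \<Rightarrow>
      Poly_Mapping.single (a, b - 1, c) (of_nat b * Poly_Mapping.lookup p m))"
definition dz :: "poly3 \<Rightarrow> poly3" where
  "dz p = (\<Sum>m\<in>Poly_Mapping.keys p. case m of (a,b,c) \<Rightarrow>
      Poly_Mapping.single (a, b, c - 1) (of_nat c * Poly_Mapping.lookup p m))"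

definition eval3 :: "poly3 \<Rightarrow> complex \<times> complex \<times> complex \<Rightarrow> complex" where
  "eval3 p q = (\<Sum>m\<in>Poly_Mapping.keys p. case m of (a,b,c) \<Rightarrow>
      Poly_Mapping.lookup p m * fst q ^ a * fst (snd q) ^ b * snd (snd q) ^ c)"

definition reduced :: "poly3 \<Rightarrow> bool" where
  "reduced f \<longleftrightarrow> f \<noteq> 0 \<and> (\<forall>g. g * g dvd f \<longrightarrow> g dvd 1)"

definition lines_through_point :: "nat \<Rightarrow> poly3 \<Rightarrow> bool" where
  "lines_through_point d f \<longleftrightarrow>
     (\<exists>q::complex \<times> complex \<times> complex. q \<noteq> (0,0,0) \<and>
       (\<exists>L::nat \<Rightarrow> poly3. (\<forall>i<d. homog 1 (L i) \<and> L i \<noteq> 0 \<and> eval3 (L i) q = 0)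
          \<and> f = (\<Prod>i<d. L i)))"

text \<open>Free modules S^n are represented as maps nat => S vanishing from index n on.\<close>
type_synonym vec3 = "nat \<Rightarrow> poly3"

definition vscale :: "complex \<Rightarrow> vec3 \<Rightarrow> vec3" where
  "vscale c v = (\<lambda>i. cscale c (v i))"

definition cdim :: "vec3 set \<Rightarrow> nat" where
  "cdim V = vector_space.dim vscale V"

definition pdim :: "poly3 set \<Rightarrow> nat" where
  "pdim V = vector_space.dim cscale V"

text \<open>Degree-k graded piece of a graded submodule M of S^n (all shifts zero).\<close>
definition gpiece :: "vec3 set \<Rightarrow> nat \<Rightarrow> vec3 set" where
  "gpiece M k = {v \<in> M. \<forall>i. homog k (v i)}"

text \<open>Degree-k part of S_+ M.\<close>
definition decomp_piece :: "vec3 set \<Rightarrow> nat \<Rightarrow> vec3 set" where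
  "decomp_piece M k = {(\<lambda>i. s * v i) | s v j. 1 \<le> j \<and> j \<le> k \<and> homog j s \<and> v \<in> gpiece M (k - j)}"

text \<open>Number of minimal homogeneous generators of degree k of a graded module M,
  i.e. dim_C (M / S_+ M)_k.\<close>
definition num_gens :: "vec3 set \<Rightarrow> nat \<Rightarrow> nat" where
  "num_gens M k = cdim (gpiece M k) - cdim (decomp_piece M k)"

definition submod_gen :: "vec3 set \<Rightarrow> vec3 set" where
  "submod_gen G = {(\<lambda>i. \<Sum>j\<in>A. c j * g j i) | A c g. finite (A::nat set) \<and> g ` A \<subseteq> G}"

definition D0 :: "poly3 \<Rightarrow> vec3 set" where
  "D0 f = {v. (\<forall>i\<ge>3. v i = 0) \<and> v 0 * dx f + v 1 * dy f + v 2 * dz f = 0}"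

definition syz :: "nat \<Rightarrow> (nat \<Rightarrow> vec3) \<Rightarrow> vec3 set" where
  "syz m \<rho> = {c. (\<forall>j\<ge>m. c j = 0) \<and> (\<lambda>i. \<Sum>j<m. c j * \<rho> j i) = (\<lambda>i. 0)}"

definition jac_piece :: "nat \<Rightarrow> poly3 \<Rightarrow> nat \<Rightarrow> poly3 set" where
  "jac_piece d f k = (if k + 1 < d then {0} else
     {a * dx f + b * dy f + c * dz f | a b c.
        homog (k + 1 - d) a \<and> homog (k + 1 - d) b \<and> homog (k + 1 - d) c})"

text \<open>Total Tjurina number: the degree of J_f, i.e. the (eventually constant)
  value of dim (S/J_f)_k for k large.\<close>
definition tjurina :: "nat \<Rightarrow> poly3 \<Rightarrow> nat" where
  "tjurina d f = (THE t. \<exists>K. \<forall>k\<ge>K. pdim {p. homog k p} - pdim (jac_piece d f k) = t)"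

definition min_gen_system :: "poly3 \<Rightarrow> nat \<Rightarrow> nat \<Rightarrow> (nat \<Rightarrow> vec3) \<Rightarrow> bool" where
  "min_gen_system f r m \<rho> \<longleftrightarrow>
     (\<forall>j<m. \<rho> j \<in> gpiece (D0 f) r) \<and>
     submod_gen (\<rho> ` {..<m}) = D0 f \<and>
     (\<forall>j<m. \<rho> j \<notin> submod_gen (\<rho> ` ({..<m} - {j})))"

end

theory Submission
  imports Defs "HOL-Computational_Algebra.Polynomial_Factorial" "HOL-Computational_Algebra.Field_as_Ring"
begin

text \<open>
  The syzygy module \<open>N = syz m \<rho>\<close> is a third syzygy module of \<open>S/J\<close>, so \<open>x, y, z\<close> is a regular
  sequence on it; consequently \<open>dim (N/(x,y,z)N)\<^sub>k\<close>, the number of minimal generators of degree \<open>k\<close>, is the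
  third difference of the Hilbert function of \<open>N\<close>. The exact sequences \<open>0 \<rightarrow> N \<rightarrow> S\<^sup>m \<rightarrow> D0 \<rightarrow> 0\<close> and
  \<open>0 \<rightarrow> D0 \<rightarrow> S\<^sup>3 \<rightarrow> J \<rightarrow> 0\<close> express that Hilbert function through the one of \<open>S/J\<close>. Since \<open>f\<close> is reduced,
  its partial derivatives have no common factor (a common prime factor would divide \<open>f\<close> by Euler's
  identity, hence twice), so \<open>J\<close> contains two coprime forms of degree \<open>d - 1\<close> and the Hilbert function
  of \<open>S/J\<close> is bounded. Boundedness makes the numbers \<open>\<beta>\<^sub>k\<close> of generators finitely supported, makes
  the Hilbert function of \<open>S/J\<close> eventually constant, and forces \<open>\<Sum> \<beta>\<^sub>k = m - 2\<close> and \<open>\<Sum> k \<beta>\<^sub>k = m\<close>.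
  As \<open>\<beta>\<^sub>0 = 0\<close> by minimality, \<open>\<Sum> (k - 1) \<beta>\<^sub>k = 2\<close> leaves exactly two possibilities, and the second
  moment \<open>\<Sum> k\<^sup>2 \<beta>\<^sub>k\<close> determines the eventual value \<open>\<tau>\<close>.
\<close>

section \<open>Dimension formulas in vector spaces\<close>

text \<open>Grassmann's formula: a basis \<open>E\<close> of the intersection extends to bases
  \<open>G\<close> of \<open>A\<close> and \<open>D\<close> of \<open>B\<close>, and
  \<open>G \<union> (D - E)\<close> is a basis of the sum. The set \<open>F\<close> keeps all these
  bases finite, so that their cardinalities carry information.\<close>

lemma (in vector_space) dim_sum_Int:
  assumes A: "subspace A" "A \<subseteq> span F" and B: "subspace B" "B \<subseteq> span F" and F: "finite F"
  shows "dim {x + y |x y. x \<in> A \<and> y \<in> B} + dim (A \<inter> B) = dim A + dim B"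
proof -
  obtain E where E: "E \<subseteq> A \<inter> B" "independent E" "A \<inter> B \<subseteq> span E"
    using maximal_independent_subset by blast
  obtain G where G: "E \<subseteq> G" "G \<subseteq> A" "independent G" "A \<subseteq> span G"
    using maximal_independent_subset_extend[of E A] E by blast
  obtain D where D: "E \<subseteq> D" "D \<subseteq> B" "independent D" "B \<subseteq> span D"
    using maximal_independent_subset_extend[of E B] E by blast
  have fin: "finite G" "finite D"
    using independent_span_bound[OF F] G D A B by (meson order_trans)+
  have notE: "d \<notin> span E" if "d \<in> D - E" for d
  proof
    assume "d \<in> span E"
    moreover have "span E \<subseteq> span (D - {d})" using that D(1) by (intro span_mono) auto
    ultimately show False using D(3) that by (auto simp: dependent_def)
  qed
  have disj: "G \<inter> (D - E) = {}"
    using notE G(2) D(2) E(3) by blast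
  have indep: "independent (G \<union> D')" if "finite D'" "D' \<subseteq> D - E" for D'
    using that
  proof (induction D' rule: finite_induct)
    case empty
    then show ?case using G by simp
  next
    case (insert d D')
    have "d \<notin> span (G \<union> D')"
    proof
      assume "d \<in> span (G \<union> D')"
      then obtain a w where aw: "d = a + w" "a \<in> span G" "w \<in> span D'"
        by (auto simp: span_Un)
      \<comment> \<open>\<open>a\<close> lies in \<open>A\<close>, and in \<open>B\<close> because
        \<open>a = d - w\<close>; hence it lies in \<open>span E\<close>, which would make
        \<open>d\<close> depend on the rest of \<open>D\<close>.\<close>
      have "a \<in> A" using aw(2) G(2) A(1) span_minimal by blast
      moreover have "span D' \<subseteq> B" using insert.prems D(2) B(1) by (intro span_minimal) auto
      then have "a \<in> B" using aw(1,3) insert.prems D(2) B(1)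
        by (metis Diff_subset add_diff_cancel_right' insert_subset subset_iff subspace_diff)
      ultimately have "a \<in> span E" using E by auto
      then have "d \<in> span (E \<union> D')" using aw by (auto simp: span_Un)
      moreover have "span (E \<union> D') \<subseteq> span (D - {d})"
        using D(1) insert by (intro span_mono) auto
      ultimately show False using D(3) insert.prems by (auto simp: dependent_def)
    qed
    moreover have "independent (G \<union> D')" using insert by simp
    ultimately have "independent (insert d (G \<union> D'))" by (rule independent_insertI)
    then show ?case unfolding Un_insert_right .
  qed
  have "dim {x + y |x y. x \<in> A \<and> y \<in> B} = card (G \<union> (D - E))"
  proof (rule dim_eq_card)
    show "independent (G \<union> (D - E))" using indep fin by auto
    have "span G = A" "span D = B"
      using span_subspace[OF G(2,4) A(1)] span_subspace[OF D(2,4) B(1)] by simp_all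
    then have "{x + y |x y. x \<in> A \<and> y \<in> B} = span (G \<union> D)" unfolding span_Un by simp
    moreover have "G \<union> (D - E) = G \<union> D" using G D by auto
    ultimately show "span (G \<union> (D - E)) = span {x + y |x y. x \<in> A \<and> y \<in> B}"
      by (simp only: span_span)
  qed
  also have "\<dots> = card G + (card D - card E)"
    using disj fin D(1) by (simp add: card_Un_disjoint card_Diff_subset finite_subset)
  moreover have "card E \<le> card D" using D fin by (simp add: card_mono)
  ultimately show ?thesis
    using basis_card_eq_dim[OF E(1,3,2)] basis_card_eq_dim[OF G(2,4,3)] basis_card_eq_dim[OF D(2,4,3)]
    by simp
qed

lemma (in vector_space) dim_mono_finite:
  assumes "U \<subseteq> W" "W \<subseteq> span F" "finite F"
  shows "dim U \<le> dim W"
proof -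
  obtain B where B: "B \<subseteq> W" "independent B" "W \<subseteq> span B" "card B = dim W"
    using basis_exists by blast
  then have "finite B" using assms independent_span_bound by (meson order_trans)
  then show ?thesis using dim_le_card[of U B] B assms by auto
qed

lemma (in vector_space) dim_zero: "dim {0} = 0"
  using dim_eq_card[of "{}" "{0}"] independent_empty by simp

text \<open>A basis \<open>E\<close> of the kernel extends to a basis \<open>B\<close> of
  \<open>U\<close>; on the span of \<open>B - E\<close> the map is injective, so the image of
  \<open>B - E\<close> is a basis of the image of \<open>U\<close>.\<close>

lemma (in vector_space_pair) rank_nullity:
  assumes f: "Vector_Spaces.linear s1 s2 f" and U: "vs1.subspace U" "U \<subseteq> vs1.span F" "finite F"
  shows "vs2.dim (f ` U) + vs1.dim {x \<in> U. f x = 0} = vs1.dim U"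
proof -
  let ?K = "{x \<in> U. f x = 0}"
  obtain E where E: "E \<subseteq> ?K" "vs1.independent E" "?K \<subseteq> vs1.span E"
    using vs1.maximal_independent_subset by blast
  obtain B where B: "E \<subseteq> B" "B \<subseteq> U" "vs1.independent B" "U \<subseteq> vs1.span B"
    using vs1.maximal_independent_subset_extend[of E U] E by blast
  have fin: "finite B"
    using vs1.independent_span_bound[OF U(3) B(3)] B U by auto
  let ?D = "B - E"
  have iD: "vs1.independent ?D" using B(3) by (rule vs1.independent_mono) auto
  have inj0: "x = 0" if x: "x \<in> vs1.span ?D" "f x = 0" for x
  proof -
    have "vs1.span ?D \<subseteq> U" using B U(1) by (intro vs1.span_minimal) auto
    then have xE: "x \<in> vs1.span E" using x E by auto
    \<comment> \<open>The coordinates of \<open>x\<close> over \<open>B\<close> are supported both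
      in \<open>E\<close> and in \<open>B - E\<close>, so all of them vanish.\<close>
    have "vs1.representation B x = vs1.representation E x"
      "vs1.representation B x = vs1.representation ?D x"
      using vs1.representation_extend[OF B(3)] xE x B(1) by blast+
    then have "vs1.representation E x b = 0" for b
      using vs1.representation_ne_zero[of E x b] vs1.representation_ne_zero[of ?D x b] by auto
    then show ?thesis
      using vs1.sum_nonzero_representation_eq[OF E(2) xE] by simp
  qed
  interpret f: module_hom s1 s2 f using f by (simp add: module_hom_iff_linear)
  have inj: "inj_on f (vs1.span ?D)"
    by (subst f.inj_on_iff_eq_0) (auto intro: inj0)
  have "vs2.dim (f ` U) = card (f ` ?D)"
  proof (rule vs2.dim_unique)
    show "f ` ?D \<subseteq> f ` U" using B by auto
    show "vs2.independent (f ` ?D)" using f.independent_injective_image[OF iD inj] .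
    have "f ` U \<subseteq> vs2.span (f ` B)" using f.span_image B(4) by auto
    also have "\<dots> \<subseteq> vs2.span (insert 0 (f ` ?D))" using E by (intro vs2.span_mono) auto
    finally show "f ` U \<subseteq> vs2.span (f ` ?D)" by simp
  qed simp
  also have "\<dots> = card B - card E"
    using inj_on_subset[OF inj vs1.span_superset] B(1) fin
    by (simp add: card_image card_Diff_subset finite_subset)
  finally show ?thesis
    using vs1.basis_card_eq_dim[OF E(1,3,2)] vs1.basis_card_eq_dim[OF B(2,4,3)] card_mono[OF fin B(1)]
    by simp
qed

lemma (in vector_space_pair) dim_inj_image:
  assumes "Vector_Spaces.linear s1 s2 f" "vs1.subspace U" "U \<subseteq> vs1.span F" "finite F"
    and "\<And>x. x \<in> U \<Longrightarrow> f x = 0 \<Longrightarrow> x = 0"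
  shows "vs2.dim (f ` U) = vs1.dim U"
proof -
  have "f 0 = 0" using assms(1) linear_0 by blast
  then have K: "{x \<in> U. f x = 0} = {0}" using assms vs1.subspace_0 by auto
  with rank_nullity[OF assms(1-4)] show ?thesis by (simp add: vs1.dim_zero)
qed

section \<open>Polynomials and polynomial vectors as complex vector spaces\<close>

interpretation P: vector_space cscale
proof
  show "cscale a (x + y) = cscale a x + cscale a y" for a x y by (simp add: cscale_def algebra_simps)
  show "cscale (a + b) x = cscale a x + cscale b x" for a b x by (simp add: cscale_def single_add algebra_simps)
  show "cscale a (cscale b x) = cscale (a * b) x" for a b x
    by (simp add: cscale_def mult.assoc[symmetric] mult_single)
  show "cscale 1 x = x" for x 
    by (simp add: cscale_def flip: zero_prod_def)
qed

interpretation V: vector_space vscale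
  by standard (auto simp: vscale_def fun_eq_iff P.scale_right_distrib P.scale_left_distrib)

interpretation PP: vector_space_pair cscale cscale ..
interpretation VV: vector_space_pair vscale vscale ..
interpretation VP: vector_space_pair vscale cscale ..

section \<open>Ternary forms\<close>

text \<open>Reduces every identity that is additive in the polynomial to monomials, on which
  products and derivatives are explicit.\<close>

lemma poly3_induct [case_names single add]:
  fixes p :: poly3
  assumes single: "\<And>a b c k. P (Poly_Mapping.single (a, b, c) k)"
    and add: "\<And>p q. P p \<Longrightarrow> P q \<Longrightarrow> P (p + q)"
  shows "P p"
proof (induction p rule: update_induct)
  case const
  show ?case using single[of 0 0 0 0] by simp
next
  case (update f m c)
  have "Poly_Mapping.update m c f = Poly_Mapping.single m c + f"
    using update(1)
    by (intro poly_mapping_eqI)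
      (auto simp: lookup_update lookup_add lookup_single when_def in_keys_iff)
  then show ?case using single[of "fst m" "fst (snd m)" "snd (snd m)" c] add update by simp
qed

lemma lookup_var_x: "Poly_Mapping.lookup (var_x * p) (a, b, c) = (if a = 0 then 0 else Poly_Mapping.lookup p (a - 1, b, c))"
  by (induction p rule: poly3_induct)
    (auto simp: var_x_def mult_single lookup_single when_def lookup_add algebra_simps)

lemma lookup_var_y: "Poly_Mapping.lookup (var_y * p) (a, b, c) = (if b = 0 then 0 else Poly_Mapping.lookup p (a, b - 1, c))"
  by (induction p rule: poly3_induct)
    (auto simp: var_y_def mult_single lookup_single when_def lookup_add algebra_simps)

lemma lookup_var_z: "Poly_Mapping.lookup (var_z * p) (a, b, c) = (if c = 0 then 0 else Poly_Mapping.lookup p (a, b, c - 1))"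
  by (induction p rule: poly3_induct)
    (auto simp: var_z_def mult_single lookup_single when_def lookup_add algebra_simps)

lemmas lookup_var = lookup_var_x lookup_var_y lookup_var_z

lemma lookup_cscale: "Poly_Mapping.lookup (cscale k p) m = k * Poly_Mapping.lookup p m"
  by (induction p rule: poly3_induct)
    (auto simp: cscale_def mult_single lookup_single when_def lookup_add algebra_simps simp flip: zero_prod_def)

lemma poly3_eqI:
  assumes "\<And>a b c. Poly_Mapping.lookup p (a, b, c) = Poly_Mapping.lookup q (a, b, c)"
  shows "p = (q :: poly3)"
  using assms by (intro poly_mapping_eqI) (metis prod_cases3)

lemma poly3_eq_iff:
  "p = (q :: poly3) \<longleftrightarrow> (\<forall>a b c. Poly_Mapping.lookup p (a, b, c) = Poly_Mapping.lookup q (a, b, c))"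
  using poly3_eqI by blast

text \<open>Integer degrees make shifts such as \<open>k - 3\<close> meaningful in all degrees:
  below 0 only the zero polynomial is left.\<close>

definition homogZ :: "int \<Rightarrow> poly3 \<Rightarrow> bool" where
  "homogZ k p \<longleftrightarrow> (\<forall>m\<in>Poly_Mapping.keys p. int (mdeg m) = k)"

lemma homog_iff_homogZ: "homog n p \<longleftrightarrow> homogZ (int n) p"
  by (simp add: homog_def homogZ_def)

lemma homogZ_iff: "homogZ k p \<longleftrightarrow> (\<forall>a b c. Poly_Mapping.lookup p (a, b, c) \<noteq> 0 \<longrightarrow> int a + int b + int c = k)"
  by (force simp: homogZ_def mdeg_def in_keys_iff)

lemma homogZ_0 [simp]: "homogZ k 0" by (simp add: homogZ_def)

lemma homogZ_neg: "k < 0 \<Longrightarrow> homogZ k p \<longleftrightarrow> p = 0"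
  by (auto simp: homogZ_iff intro!: poly3_eqI)

lemma homogZ_add: "homogZ k p \<Longrightarrow> homogZ k q \<Longrightarrow> homogZ k (p + q)"
  unfolding homogZ_iff lookup_add by (metis add_0)

lemma homogZ_diff: "homogZ k p \<Longrightarrow> homogZ k q \<Longrightarrow> homogZ k (p - q)"
  unfolding homogZ_iff lookup_minus by (metis diff_0_right)

lemma homogZ_sum: "(\<And>i. i \<in> A \<Longrightarrow> homogZ k (f i)) \<Longrightarrow> homogZ k (sum f A)"
  by (induction A rule: infinite_finite_induct) (auto intro: homogZ_add)

lemma homogZ_cscale: "homogZ k p \<Longrightarrow> homogZ k (cscale c p)"
  by (auto simp: homogZ_iff lookup_cscale)

lemma homogZ_mult: "homogZ j p \<Longrightarrow> homogZ k q \<Longrightarrow> homogZ (j + k) (p * q)"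
  using keys_mult[of p q] by (force simp: homogZ_def mdeg_def)

lemma homogZ_var [simp]: "homogZ 1 var_x" "homogZ 1 var_y" "homogZ 1 var_z"
  by (auto simp: homogZ_def var_x_def var_y_def var_z_def mdeg_def)

section \<open>Cancellation, division and regularity of the variables\<close>

lemma var_cancel [simp]:
  "var_x * p = var_x * q \<longleftrightarrow> p = q" "var_y * p = var_y * q \<longleftrightarrow> p = q" "var_z * p = var_z * q \<longleftrightarrow> p = q"
proof -
  have "p = q" if "var_x * p = var_x * q"
    using arg_cong[OF that, of "\<lambda>r. Poly_Mapping.lookup r (Suc a, b, c)" for a b c]
    by (intro poly3_eqI) (simp add: lookup_var)
  moreover have "p = q" if "var_y * p = var_y * q"
    using arg_cong[OF that, of "\<lambda>r. Poly_Mapping.lookup r (a, Suc b, c)" for a b c]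
    by (intro poly3_eqI) (simp add: lookup_var)
  moreover have "p = q" if "var_z * p = var_z * q"
    using arg_cong[OF that, of "\<lambda>r. Poly_Mapping.lookup r (a, b, Suc c)" for a b c]
    by (intro poly3_eqI) (simp add: lookup_var)
  ultimately show "var_x * p = var_x * q \<longleftrightarrow> p = q" "var_y * p = var_y * q \<longleftrightarrow> p = q"
    "var_z * p = var_z * q \<longleftrightarrow> p = q" by blast+
qed

lemma var_eq_0 [simp]: "var_x * p = 0 \<longleftrightarrow> p = 0" "var_y * p = 0 \<longleftrightarrow> p = 0" "var_z * p = 0 \<longleftrightarrow> p = 0"
  using var_cancel[of p 0] by simp_all

text \<open>Division by a variable that drops the monomials free of it. Being explicit functions,
  the quotients respect degrees and can be taken coordinatewise in vectors.\<close>

definition quot_x :: "poly3 \<Rightarrow> poly3" where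
  "quot_x p = Poly_Mapping.map_key (\<lambda>(a, b, c). (Suc a, b, c)) p"
definition quot_y :: "poly3 \<Rightarrow> poly3" where
  "quot_y p = Poly_Mapping.map_key (\<lambda>(a, b, c). (a, Suc b, c)) p"
definition quot_z :: "poly3 \<Rightarrow> poly3" where
  "quot_z p = Poly_Mapping.map_key (\<lambda>(a, b, c). (a, b, Suc c)) p"

lemma lookup_quot:
  "Poly_Mapping.lookup (quot_x p) (a, b, c) = Poly_Mapping.lookup p (Suc a, b, c)"
  "Poly_Mapping.lookup (quot_y p) (a, b, c) = Poly_Mapping.lookup p (a, Suc b, c)"
  "Poly_Mapping.lookup (quot_z p) (a, b, c) = Poly_Mapping.lookup p (a, b, Suc c)"
  unfolding quot_x_def quot_y_def quot_z_def
  by (subst map_key.rep_eq; force simp: inj_def)+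

lemma homogZ_quot:
  assumes "homogZ k p"
  shows "homogZ (k - 1) (quot_x p)" "homogZ (k - 1) (quot_y p)" "homogZ (k - 1) (quot_z p)"
  using assms by (fastforce simp: homogZ_iff lookup_quot)+

lemma quot_0 [simp]: "quot_x 0 = 0" "quot_y 0 = 0" "quot_z 0 = 0"
  by (simp_all add: poly3_eq_iff lookup_quot)

text \<open>This lemma and the next two give the regularity of the variables on the polynomial ring,
  with explicit quotients: the obstructing coefficients of \<open>p\<close> sit at monomials that
  cannot occur on the right-hand side of the assumption.\<close>

lemma var_x_regular:
  assumes "var_y * p = var_x * q"
  shows "p = var_x * quot_x p"
proof (rule poly3_eqI)
  fix a b c
  have "Poly_Mapping.lookup (var_y * p) (0, Suc b, c) = Poly_Mapping.lookup (var_x * q) (0, Suc b, c)"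
    using assms by simp
  then show "Poly_Mapping.lookup p (a, b, c) = Poly_Mapping.lookup (var_x * quot_x p) (a, b, c)"
    by (cases a) (auto simp: lookup_var lookup_quot)
qed

lemma var_y_regular:
  assumes "var_x * p = var_y * q"
  shows "p = var_y * quot_y p"
proof (rule poly3_eqI)
  fix a b c
  have "Poly_Mapping.lookup (var_x * p) (Suc a, 0, c) = Poly_Mapping.lookup (var_y * q) (Suc a, 0, c)"
    using assms by simp
  then show "Poly_Mapping.lookup p (a, b, c) = Poly_Mapping.lookup (var_y * quot_y p) (a, b, c)"
    by (cases b) (auto simp: lookup_var lookup_quot)
qed

lemma var_z_regular:
  assumes "var_z * p = var_x * q + var_y * q'"
  shows "p = var_x * quot_x p + var_y * quot_y (p - var_x * quot_x p)"
proof (rule poly3_eqI)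
  fix a b c
  have "Poly_Mapping.lookup (var_z * p) (0, 0, Suc c) = Poly_Mapping.lookup (var_x * q + var_y * q') (0, 0, Suc c)"
    using assms by simp
  then show "Poly_Mapping.lookup p (a, b, c) =
      Poly_Mapping.lookup (var_x * quot_x p + var_y * quot_y (p - var_x * quot_x p)) (a, b, c)"
    by (cases a; cases b) (auto simp: lookup_var lookup_quot lookup_add lookup_minus)
qed

text \<open>Splitting off the multiples of \<open>var_x\<close>, then of \<open>var_y\<close>,
  leaves a polynomial in z alone, without constant term as \<open>k \<ge> 1\<close>. This replaces
  multiplication by arbitrary forms of positive degree by multiplication by the three
  variables.\<close>

lemma homogZ_split:
  assumes "homogZ k p" "k \<ge> 1"
  obtains p1 p2 p3 where "homogZ (k - 1) p1" "homogZ (k - 1) p2" "homogZ (k - 1) p3"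
    "p = var_x * p1 + var_y * p2 + var_z * p3"
proof -
  define q where "q = p - var_x * quot_x p"
  have hx: "homogZ k (var_x * p')" "homogZ k (var_y * p')" if "homogZ (k - 1) p'" for p'
    using homogZ_mult[OF homogZ_var(1) that] homogZ_mult[OF homogZ_var(2) that] by simp_all
  have q: "homogZ k q" using assms hx homogZ_quot by (auto simp: q_def intro!: homogZ_diff)
  define r where "r = q - var_y * quot_y q"
  have r: "homogZ k r" using q hx homogZ_quot by (auto simp: r_def intro!: homogZ_diff)
  have "r = var_z * quot_z r"
  proof (rule poly3_eqI)
    fix a b c
    have "Poly_Mapping.lookup r (0, 0, 0) = 0" using r assms(2) unfolding homogZ_iff by force
    then show "Poly_Mapping.lookup r (a, b, c) = Poly_Mapping.lookup (var_z * quot_z r) (a, b, c)"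
      by (cases a; cases b; cases c) (auto simp: lookup_var lookup_quot lookup_minus q_def r_def)
  qed
  then have "p = var_x * quot_x p + var_y * quot_y q + var_z * quot_z r"
    by (simp add: q_def r_def algebra_simps)
  then show ?thesis
    by (rule that[OF homogZ_quot(1)[OF assms(1)] homogZ_quot(2)[OF q] homogZ_quot(3)[OF r]])
qed

section \<open>Partial derivatives: coefficients, Euler's identity, Leibniz rule\<close>

lemma dx_single: "dx (Poly_Mapping.single (a, b, c) k) = Poly_Mapping.single (a - 1, b, c) (of_nat a * k)"
  and dy_single: "dy (Poly_Mapping.single (a, b, c) k) = Poly_Mapping.single (a, b - 1, c) (of_nat b * k)"
  and dz_single: "dz (Poly_Mapping.single (a, b, c) k) = Poly_Mapping.single (a, b, c - 1) (of_nat c * k)"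
  by (auto simp: dx_def dy_def dz_def)

lemma dx_add: "dx (p + q) = dx p + dx q"
  unfolding dx_def
  by (rule setsum_keys_plus_distrib[where f = "\<lambda>m k. case m of (a, b, c) \<Rightarrow>
        Poly_Mapping.single (a - 1, b, c) (of_nat a * k)"])
    (auto simp: algebra_simps single_add split: prod.splits)

lemma dy_add: "dy (p + q) = dy p + dy q"
  unfolding dy_def
  by (rule setsum_keys_plus_distrib[where f = "\<lambda>m k. case m of (a, b, c) \<Rightarrow>
        Poly_Mapping.single (a, b - 1, c) (of_nat b * k)"])
    (auto simp: algebra_simps single_add split: prod.splits)

lemma dz_add: "dz (p + q) = dz p + dz q"
  unfolding dz_def
  by (rule setsum_keys_plus_distrib[where f = "\<lambda>m k. case m of (a, b, c) \<Rightarrow>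
        Poly_Mapping.single (a, b, c - 1) (of_nat c * k)"])
    (auto simp: algebra_simps single_add split: prod.splits)

lemma lookup_dx: "Poly_Mapping.lookup (dx p) (a, b, c) = of_nat (Suc a) * Poly_Mapping.lookup p (Suc a, b, c)"
  by (induction p rule: poly3_induct)
    (auto simp: dx_single dx_add lookup_single when_def lookup_add algebra_simps simp del: of_nat_Suc)

lemma lookup_dy: "Poly_Mapping.lookup (dy p) (a, b, c) = of_nat (Suc b) * Poly_Mapping.lookup p (a, Suc b, c)"
  by (induction p rule: poly3_induct)
    (auto simp: dy_single dy_add lookup_single when_def lookup_add algebra_simps simp del: of_nat_Suc)

lemma lookup_dz: "Poly_Mapping.lookup (dz p) (a, b, c) = of_nat (Suc c) * Poly_Mapping.lookup p (a, b, Suc c)"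
  by (induction p rule: poly3_induct)
    (auto simp: dz_single dz_add lookup_single when_def lookup_add algebra_simps simp del: of_nat_Suc)

lemmas lookup_deriv = lookup_dx lookup_dy lookup_dz

lemma homogZ_deriv:
  assumes "homogZ k p"
  shows "homogZ (k - 1) (dx p)" "homogZ (k - 1) (dy p)" "homogZ (k - 1) (dz p)"
  using assms by (fastforce simp: homogZ_iff lookup_deriv)+

lemma euler:
  assumes "homog d p"
  shows "var_x * dx p + var_y * dy p + var_z * dz p = of_nat d * p"
proof (rule poly3_eqI)
  fix a b c
  have 1: "of_nat d * p = cscale (of_nat d) p" by (simp add: cscale_def single_of_nat flip: zero_prod_def)
  have "Poly_Mapping.lookup p (a, b, c) = 0 \<or> d = a + b + c"
    using assms by (force simp: homog_iff_homogZ homogZ_iff)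
  then show "Poly_Mapping.lookup (var_x * dx p + var_y * dy p + var_z * dz p) (a, b, c) =
      Poly_Mapping.lookup (of_nat d * p) (a, b, c)"
    unfolding 1
    by (cases a; cases b; cases c) (auto simp: lookup_var lookup_deriv lookup_add lookup_cscale algebra_simps)
qed

lemma dx_mult: "dx (p * q) = dx p * q + p * dx q"
proof (induction p rule: poly3_induct)
  case (single a b c k)
  show ?case
  proof (induction q rule: poly3_induct)
    case (single a' b' c' k')
    show ?case by (cases a; cases a') (simp_all add: mult_single dx_single algebra_simps flip: single_add)
  qed (simp add: dx_add algebra_simps)
qed (simp add: dx_add algebra_simps)

lemma dy_mult: "dy (p * q) = dy p * q + p * dy q"
proof (induction p rule: poly3_induct)
  case (single a b c k)
  show ?case
  proof (induction q rule: poly3_induct)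
    case (single a' b' c' k')
    show ?case by (cases b; cases b') (simp_all add: mult_single dy_single algebra_simps flip: single_add)
  qed (simp add: dy_add algebra_simps)
qed (simp add: dy_add algebra_simps)

lemma dz_mult: "dz (p * q) = dz p * q + p * dz q"
proof (induction p rule: poly3_induct)
  case (single a b c k)
  show ?case
  proof (induction q rule: poly3_induct)
    case (single a' b' c' k')
    show ?case by (cases c; cases c') (simp_all add: mult_single dz_single algebra_simps flip: single_add)
  qed (simp add: dz_add algebra_simps)
qed (simp add: dz_add algebra_simps)

section \<open>Unique factorization and coprime elements of the Jacobian ideal\<close>

text \<open>The isomorphism of C[x,y,z] with C[z][y][x], z innermost, along which integrality and
  unique factorization are transported from iterated univariate polynomials.\<close>

definition nested :: "poly3 \<Rightarrow> complex poly poly poly" where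
  "nested p = (\<Sum>m\<in>Poly_Mapping.keys p. case m of (a, b, c) \<Rightarrow>
      monom (monom (monom (Poly_Mapping.lookup p m) c) b) a)"

lemma nested_single: "nested (Poly_Mapping.single (a, b, c) k) = monom (monom (monom k c) b) a"
  by (simp add: nested_def)

lemma nested_add: "nested (p + q) = nested p + nested q"
  unfolding nested_def
  by (rule setsum_keys_plus_distrib[where f = "\<lambda>m k. case m of (a, b, c) \<Rightarrow> monom (monom (monom k c) b) a"])
    (auto simp: add_monom split: prod.splits)

lemma nested_mult: "nested (p * q) = nested p * nested q"
proof (induction p rule: poly3_induct)
  case (single a b c k)
  show ?case
    by (induction q rule: poly3_induct) (simp_all add: mult_single mult_monom nested_single nested_add algebra_simps)
qed (simp add: nested_add algebra_simps)

lemma coeff_nested: "coeff (coeff (coeff (nested p) a) b) c = Poly_Mapping.lookup p (a, b, c)"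
  by (induction p rule: poly3_induct)
    (auto simp: nested_single nested_add lookup_single lookup_add when_def)

lemma nested_eq_iff [simp]: "nested p = nested q \<longleftrightarrow> p = q"
  by (metis coeff_nested poly3_eqI)

lemma nested_0 [simp]: "nested 0 = 0" by (simp add: nested_def)
lemma nested_1 [simp]: "nested 1 = 1"
  using nested_single[of 0 0 0 1] by (simp flip: zero_prod_def)

lemma nested_eq_0 [simp]: "nested p = 0 \<longleftrightarrow> p = 0"
  by (metis nested_0 nested_eq_iff)

lemma nested_surj: "\<exists>p. nested p = q"
proof -
  have "\<exists>p. nested p = [:[:r:]:]" for r :: "complex poly"
  proof (induction r)
    case 0
    show ?case using nested_0 by (metis pCons_0_0)
  next
    case (pCons k r)
    then obtain p where "nested p = [:[:r:]:]" by blast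
    then have "nested (Poly_Mapping.single (0, 0, 0) k + var_z * p) = [:[:pCons k r:]:]"
      by (simp add: nested_add nested_mult nested_single var_z_def monom_altdef)
    then show ?case by blast
  qed
  then have "\<exists>p. nested p = [:r:]" for r :: "complex poly poly"
  proof (induction r)
    case 0
    show ?case using nested_0 by (metis pCons_0_0)
  next
    case (pCons k r)
    then obtain p where p: "nested p = [:r:]" by blast
    obtain p0 where "nested p0 = [:[:k:]:]" using pCons by blast
    with p have "nested (p0 + var_y * p) = [:pCons k r:]"
      by (simp add: nested_add nested_mult nested_single var_y_def monom_altdef flip: one_pCons)
    then show ?case by blast
  qed
  then show ?thesis
  proof (induction q)
    case 0
    show ?case using nested_0 by blast
  next
    case (pCons k r)
    then obtain p where p: "nested p = r" by blast
    obtain p0 where "nested p0 = [:k:]" using pCons by blast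
    with p have "nested (p0 + var_x * p) = pCons k r"
      by (simp add: nested_add nested_mult nested_single var_x_def monom_altdef flip: one_pCons)
    then show ?case by blast
  qed
qed

lemma nested_dvd_iff [simp]: "nested p dvd nested q \<longleftrightarrow> p dvd q"
  unfolding dvd_def by (metis nested_eq_iff nested_mult nested_surj)

lemma poly3_mult_eq_0 [simp]: "p * q = 0 \<longleftrightarrow> p = 0 \<or> q = (0 :: poly3)"
  by (simp only: nested_eq_0[symmetric] nested_mult mult_eq_0_iff)

text \<open>Coprimality with a fixed \<open>g\<close> is tested on the finitely many prime factors
  of \<open>g\<close>, so a family member avoiding these is coprime to \<open>g\<close>. The last
  clause expresses coprimality as \<open>g\<close> being a nonzerodivisor modulo
  \<open>h\<close>.\<close>

lemma coprimality_test_primes: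
  assumes "g \<noteq> (0 :: poly3)"
  shows "\<exists>P. finite P \<and> (\<forall>p\<in>P. \<not> p dvd 1 \<and> (\<forall>u v. p dvd u * v \<longrightarrow> p dvd u \<or> p dvd v)) \<and>
    (\<forall>h a b. (\<forall>p\<in>P. \<not> p dvd h) \<longrightarrow> g * a = h * b \<longrightarrow> h dvd a)"
proof (intro exI conjI ballI allI impI)
  let ?P = "{p. nested p \<in> prime_factors (nested g)}"
  have "inj nested" by (simp add: inj_def)
  then show "finite ?P" by (metis finite_set_mset finite_vimageI vimage_def)
  fix p assume "p \<in> ?P"
  then have p: "prime_elem (nested p)" by (auto dest: in_prime_factors_imp_prime)
  have u: "p dvd 1 \<longleftrightarrow> is_unit (nested p)" by (metis nested_1 nested_dvd_iff)
  from p show "\<not> p dvd 1" unfolding u by (rule prime_elem_not_unit)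
  fix u v assume "p dvd u * v"
  then have "nested p dvd nested u * nested v" by (metis nested_dvd_iff nested_mult)
  then show "p dvd u \<or> p dvd v" using p by (simp add: prime_elem_dvd_mult_iff)
next
  let ?P = "{p. nested p \<in> prime_factors (nested g)}"
  fix h a b
  assume h: "\<forall>p\<in>?P. \<not> p dvd h" and eq: "g * a = h * b"
  have "coprime (nested g) (nested h)"
  proof (rule ccontr)
    assume "\<not> coprime (nested g) (nested h)"
    then obtain q' where q': "q' dvd nested g" "q' dvd nested h" "\<not> is_unit q'"
      by (rule not_coprimeE)
    moreover have "q' \<noteq> 0" using q'(1) assms by auto
    ultimately obtain q where "q dvd q'" and q: "prime q"
      using prime_divisor_exists[of q'] by blast
    with q' have qd: "q dvd nested g" "q dvd nested h" using dvd_trans by blast+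
    obtain p where "nested p = q" using nested_surj by blast
    moreover have "q \<in> prime_factors (nested g)"
      using q qd assms by (intro prime_factorsI) auto
    ultimately show False using h qd by auto
  qed
  moreover have "nested h dvd nested g * nested a" using eq by (metis dvd_triv_left nested_mult)
  ultimately have "nested h dvd nested a"
    by (simp add: coprime_commute coprime_dvd_mult_right_iff)
  then show "h dvd a" by simp
qed

section \<open>Homogeneous components and leading forms\<close>

definition hom_part :: "int \<Rightarrow> poly3 \<Rightarrow> poly3" where
  "hom_part k p = (\<Sum>m\<in>{m \<in> Poly_Mapping.keys p. int (mdeg m) = k}. Poly_Mapping.single m (Poly_Mapping.lookup p m))"

lemma lookup_hom_part: "Poly_Mapping.lookup (hom_part k p) m = (if int (mdeg m) = k then Poly_Mapping.lookup p m else 0)"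
  by (auto simp: hom_part_def lookup_sum lookup_single when_def in_keys_iff sum.delta)

text \<open>The lower-order terms of either factor contribute only in degrees below
  \<open>i + j\<close>, so leading forms multiply.\<close>

lemma hom_part_top_mult:
  assumes p: "\<And>m. m \<in> Poly_Mapping.keys p \<Longrightarrow> int (mdeg m) \<le> i" and q: "\<And>m. m \<in> Poly_Mapping.keys q \<Longrightarrow> int (mdeg m) \<le> j"
  shows "hom_part (i + j) (p * q) = hom_part i p * hom_part j q"
proof (rule poly_mapping_eqI)
  fix m
  let ?p = "hom_part i p" and ?q = "hom_part j q"
  have kp: "int (mdeg m) < i" if "m \<in> Poly_Mapping.keys (p - ?p)" for m
    using that p[of m] by (auto simp: in_keys_iff lookup_minus lookup_hom_part split: if_splits intro: le_neq_trans)
  have kq: "int (mdeg m) < j" if "m \<in> Poly_Mapping.keys (q - ?q)" for m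
    using that q[of m] by (auto simp: in_keys_iff lookup_minus lookup_hom_part split: if_splits intro: le_neq_trans)
  have add: "mdeg (u + v) = mdeg u + mdeg v" for u v by (simp add: mdeg_def)
  have kq': "int (mdeg m) = i" if "m \<in> Poly_Mapping.keys ?p" for m
    using that by (auto simp: in_keys_iff lookup_hom_part split: if_splits)
  have eq: "p * q = ?p * ?q + ((p - ?p) * q + ?p * (q - ?q))" by (simp add: algebra_simps)
  show "Poly_Mapping.lookup (hom_part (i + j) (p * q)) m = Poly_Mapping.lookup (?p * ?q) m"
  proof (cases "int (mdeg m) = i + j")
    case True
    have lt1: "int (mdeg (u + v)) \<noteq> i + j" if "u \<in> Poly_Mapping.keys (p - ?p)" "v \<in> Poly_Mapping.keys q" for u v
      using kp[OF that(1)] q[OF that(2)] add[of u v] by linarith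
    have lt2: "int (mdeg (u + v)) \<noteq> i + j" if "u \<in> Poly_Mapping.keys ?p" "v \<in> Poly_Mapping.keys (q - ?q)" for u v
      using kq'[OF that(1)] kq[OF that(2)] add[of u v] by linarith
    have "m \<notin> Poly_Mapping.keys ((p - ?p) * q)" "m \<notin> Poly_Mapping.keys (?p * (q - ?q))"
      using keys_mult[of "p - ?p" q] keys_mult[of ?p "q - ?q"] lt1 lt2 True by auto
    then show ?thesis using True by (subst eq) (simp add: lookup_hom_part lookup_add in_keys_iff)
  next
    case False
    have "m \<notin> Poly_Mapping.keys (?p * ?q)"
    proof
      assume "m \<in> Poly_Mapping.keys (?p * ?q)"
      then obtain u v where "m = u + v" "u \<in> Poly_Mapping.keys ?p" "v \<in> Poly_Mapping.keys ?q"
        using keys_mult by blast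
      then show False using False by (auto simp: add in_keys_iff lookup_hom_part split: if_splits)
    qed
    then show ?thesis using False by (simp add: lookup_hom_part in_keys_iff)
  qed
qed

lemma ex_top_degree:
  assumes "p \<noteq> (0 :: poly3)"
  obtains i where "\<And>m. m \<in> Poly_Mapping.keys p \<Longrightarrow> int (mdeg m) \<le> i" "hom_part i p \<noteq> 0" "0 \<le> i"
proof
  let ?i = "Max ((\<lambda>m. int (mdeg m)) ` Poly_Mapping.keys p)"
  show "int (mdeg m) \<le> ?i" if "m \<in> Poly_Mapping.keys p" for m using that by simp
  have "Poly_Mapping.keys p \<noteq> {}" using assms
    by (metis all_not_in_conv lookup_zero not_in_keys_iff_lookup_eq_zero poly_mapping_eqI)
  then have "?i \<in> (\<lambda>m. int (mdeg m)) ` Poly_Mapping.keys p" by simp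
  then obtain m where "m \<in> Poly_Mapping.keys p" "int (mdeg m) = ?i" by force
  then have "Poly_Mapping.lookup (hom_part ?i p) m \<noteq> 0" by (simp add: lookup_hom_part in_keys_iff)
  then show "hom_part ?i p \<noteq> 0" by auto
  show "0 \<le> ?i" unfolding \<open>int (mdeg m) = ?i\<close>[symmetric] by simp
qed

text \<open>A nonzero multiple \<open>p * s\<close> has the product of the two leading forms as a
  nonzero component, in a degree no smaller than that of any monomial of \<open>p\<close>.\<close>

lemma dvd_lower_degree_imp_0:
  assumes "p dvd q" and less: "\<And>m. m \<in> Poly_Mapping.keys q \<Longrightarrow> \<exists>m' \<in> Poly_Mapping.keys p. mdeg m < mdeg m'"
  shows "q = (0 :: poly3)"
proof (rule ccontr)
  assume "q \<noteq> 0"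
  obtain s where s: "q = p * s" using assms(1) by blast
  with \<open>q \<noteq> 0\<close> have "p \<noteq> 0" "s \<noteq> 0" by auto
  then obtain i j where i: "\<And>m. m \<in> Poly_Mapping.keys p \<Longrightarrow> int (mdeg m) \<le> i" "hom_part i p \<noteq> 0"
    and j: "\<And>m. m \<in> Poly_Mapping.keys s \<Longrightarrow> int (mdeg m) \<le> j" "hom_part j s \<noteq> 0" "0 \<le> j"
    using ex_top_degree by metis
  have "hom_part (i + j) q \<noteq> 0" using hom_part_top_mult[OF i(1) j(1)] i(2) j(2) s by simp
  then obtain m where "Poly_Mapping.lookup (hom_part (i + j) q) m \<noteq> 0"
    by (metis lookup_zero poly_mapping_eqI)
  then have "int (mdeg m) = i + j" "m \<in> Poly_Mapping.keys q"
    by (auto simp: lookup_hom_part in_keys_iff split: if_splits)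
  then show False using less i(1) j(3) by fastforce
qed

lemma dvd_deriv_imp_0:
  "p dvd dx p \<Longrightarrow> dx p = 0" "p dvd dy p \<Longrightarrow> dy p = 0" "p dvd dz p \<Longrightarrow> dz p = 0"
proof -
  have "\<exists>m' \<in> Poly_Mapping.keys p. mdeg m < mdeg m'"
    if "m \<in> Poly_Mapping.keys (dx p) \<union> Poly_Mapping.keys (dy p) \<union> Poly_Mapping.keys (dz p)" for m
  proof -
    obtain a b c where "m = (a, b, c)" by (metis prod_cases3)
    with that have "(Suc a, b, c) \<in> Poly_Mapping.keys p \<or> (a, Suc b, c) \<in> Poly_Mapping.keys p \<or> (a, b, Suc c) \<in> Poly_Mapping.keys p"
      by (auto simp: in_keys_iff lookup_deriv)
    then show ?thesis using \<open>m = (a, b, c)\<close> by (force simp: mdeg_def)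
  qed
  then show "p dvd dx p \<Longrightarrow> dx p = 0" "p dvd dy p \<Longrightarrow> dy p = 0" "p dvd dz p \<Longrightarrow> dz p = 0"
    by (meson UnCI dvd_lower_degree_imp_0)+
qed

text \<open>Characteristic 0: each nonconstant coefficient of \<open>p\<close> reappears in some
  partial derivative, multiplied by a positive exponent.\<close>

lemma deriv_eq_0_imp_unit:
  assumes "p \<noteq> 0" "dx p = 0" "dy p = 0" "dz p = 0"
  shows "p dvd 1"
proof -
  have "Poly_Mapping.lookup p (a, b, c) = 0" if "(a, b, c) \<noteq> (0, 0, 0)" for a b c
    using that lookup_dx[of p "a - 1" b c] lookup_dy[of p a "b - 1" c] lookup_dz[of p a b "c - 1"] assms
    by (cases a; cases b; cases c) (auto simp del: of_nat_Suc)
  then obtain k where p: "p = Poly_Mapping.single (0, 0, 0) k"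
    by (metis (mono_tags, lifting) lookup_single_eq lookup_single_not_eq poly3_eqI)
  with assms(1) have "k \<noteq> 0" by (metis single_zero)
  then have "p * Poly_Mapping.single (0, 0, 0) (1 / k) = 1"
    unfolding p by (simp add: mult_single flip: zero_prod_def)
  then show ?thesis by (metis dvd_triv_left)
qed

text \<open>By Euler's identity \<open>p\<close> divides \<open>f\<close>, say
  \<open>f = p * q\<close>, and \<open>p\<close> does not divide \<open>q\<close> since
  \<open>f\<close> is reduced. By Leibniz \<open>p\<close> then divides its own partial derivatives;
  these have lower degree, hence vanish, and \<open>p\<close> would be a unit. The hypotheses on
  \<open>p\<close> admit \<open>p = 0\<close>.\<close>

lemma reduced_prime_not_dvd_partials:
  assumes "reduced f" "homog d f" "d > 0"
    and p: "\<not> p dvd 1" "\<And>u v. p dvd u * v \<Longrightarrow> p dvd u \<or> p dvd v"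
  shows "\<not> (p dvd dx f \<and> p dvd dy f \<and> p dvd dz f)"
proof
  assume *: "p dvd dx f \<and> p dvd dy f \<and> p dvd dz f"
  then have "p dvd of_nat d * f" unfolding euler[OF assms(2), symmetric] by (simp add: dvd_add)
  moreover have "Poly_Mapping.single (0, 0, 0) (1 / of_nat d) * of_nat d = (1 :: poly3)"
    using assms(3) by (subst single_of_nat[symmetric]) (simp add: mult_single flip: zero_prod_def del: single_of_nat)
  then have "f = Poly_Mapping.single (0, 0, 0) (1 / of_nat d) * (of_nat d * f)"
    by (simp only: mult.assoc[symmetric] mult_1_left)
  ultimately have "p dvd f" by (metis dvd_mult)
  then obtain q where q: "f = p * q" by blast
  have npq: "\<not> p dvd q"
  proof
    assume "p dvd q"
    then have "p * p dvd f" using q by (simp add: mult_dvd_mono)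
    then show False using assms(1) p(1) by (auto simp: reduced_def)
  qed
  have "p dvd dx p * q" "p dvd dy p * q" "p dvd dz p * q"
    using * unfolding q dx_mult dy_mult dz_mult by (simp_all add: dvd_add_left_iff)
  then have "dx p = 0" "dy p = 0" "dz p = 0"
    using p(2) npq dvd_deriv_imp_0 by blast+
  moreover have "p \<noteq> 0" using assms(1) q by (auto simp: reduced_def)
  ultimately show False using deriv_eq_0_imp_unit p(1) by blast
qed

text \<open>At most two such \<open>t\<close> exist: by divided differences, three would force
  \<open>p\<close> to divide \<open>w\<close>, then \<open>v\<close>, then \<open>u\<close>.\<close>

lemma finite_quadratic_pencil_dvd:
  assumes "\<not> (p dvd u \<and> p dvd v \<and> p dvd (w :: poly3))"
  shows "finite {t :: complex. p dvd u + cscale t v + cscale (t * t) w}" (is "finite ?T")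
proof (rule ccontr)
  assume "infinite ?T"
  then obtain T where T: "T \<subseteq> ?T" "card T = 3" "finite T" using infinite_arbitrarily_large by blast
  then obtain t1 t2 t3 where t: "T = {t1, t2, t3}" "t1 \<noteq> t2" "t1 \<noteq> t3" "t2 \<noteq> t3" by (auto simp: card_3_iff)
  have dvd_cs: "p dvd a" if "p dvd cscale k a" "k \<noteq> 0" for k a
  proof -
    have "a = cscale (1 / k) (cscale k a)" using that by simp
    also have "p dvd \<dots>" using that unfolding cscale_def[of "1 / k"] by simp
    finally show ?thesis .
  qed
  have d: "p dvd v + cscale (s + t) w" if "s \<in> T" "t \<in> T" "s \<noteq> t" for s t
  proof (rule dvd_cs[of "s - t"])
    have "cscale (s - t) (v + cscale (s + t) w) =
       (u + cscale s v + cscale (s * s) w) - (u + cscale t v + cscale (t * t) w)"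
      by (simp add: P.scale_left_diff_distrib P.scale_right_distrib algebra_simps)
    also have "p dvd \<dots>" using that T by (intro dvd_diff) auto
    finally show "p dvd cscale (s - t) (v + cscale (s + t) w)" .
  qed (use that in auto)
  have w: "p dvd w"
  proof (rule dvd_cs[of "t2 - t3"])
    have "cscale (t2 - t3) w = (v + cscale (t1 + t2) w) - (v + cscale (t1 + t3) w)"
      by (simp add: P.scale_left_diff_distrib P.scale_left_distrib)
    also have "p dvd \<dots>" using d t by (intro dvd_diff) auto
    finally show "p dvd cscale (t2 - t3) w" .
  qed (use t in auto)
  then have cw: "p dvd cscale k w" for k unfolding cscale_def by simp
  then have v: "p dvd v" using d[of t1 t2] t by (simp add: dvd_add_left_iff)
  then have "p dvd cscale k v" for k unfolding cscale_def by simp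
  moreover have "p dvd u + cscale t1 v + cscale (t1 * t1) w" using T t by auto
  ultimately have "p dvd u" using cw by (simp add: dvd_add_left_iff)
  then show False using assms v w by blast
qed

text \<open>A one-parameter family of combinations of the partials suffices: each prime factor of
  \<open>g\<close> fails to divide some partial and so excludes only finitely many
  \<open>t\<close>.\<close>

lemma ex_coprime_in_jacobian:
  assumes "reduced f" "homog d f" "d > 0"
  obtains g t where "g \<in> {dx f, dy f, dz f}" "g \<noteq> 0" "dx f + cscale t (dy f) + cscale (t * t) (dz f) \<noteq> 0"
    "\<And>a b. g * a = (dx f + cscale t (dy f) + cscale (t * t) (dz f)) * b \<Longrightarrow>
       (dx f + cscale t (dy f) + cscale (t * t) (dz f)) dvd a"
proof -
  have n1: "\<not> (0 :: poly3) dvd 1" by simp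
  \<comment> \<open>The case \<open>p = 0\<close> says that some partial derivative is
    nonzero.\<close>
  have "\<not> (0 dvd dx f \<and> 0 dvd dy f \<and> 0 dvd dz f)"
    by (rule reduced_prime_not_dvd_partials[OF assms]) auto
  then obtain g where g: "g \<in> {dx f, dy f, dz f}" "g \<noteq> 0" by auto
  obtain P where P: "finite P"
    "\<forall>p\<in>P. \<not> p dvd 1 \<and> (\<forall>u v. p dvd u * v \<longrightarrow> p dvd u \<or> p dvd v)"
    "\<forall>h a b. (\<forall>p\<in>P. \<not> p dvd h) \<longrightarrow> g * a = h * b \<longrightarrow> h dvd a"
    using coprimality_test_primes[OF g(2)] by (elim exE conjE) (rule that)
  let ?h = "\<lambda>t. dx f + cscale t (dy f) + cscale (t * t) (dz f)"
  \<comment> \<open>Treating \<open>0\<close> like one more prime also excludes the parameters at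
    which the combination itself vanishes.\<close>
  have "finite {t. p dvd ?h t}" if "p \<in> insert 0 P" for p
    using that P(2) by (intro finite_quadratic_pencil_dvd reduced_prime_not_dvd_partials[OF assms]) auto
  then have "finite (\<Union>p\<in>insert 0 P. {t. p dvd ?h t})" using P(1) by blast
  then obtain t where "t \<notin> (\<Union>p\<in>insert 0 P. {t. p dvd ?h t})"
    using ex_new_if_finite[OF infinite_UNIV_char_0] by blast
  then have h: "?h t \<noteq> 0" "\<forall>p\<in>P. \<not> p dvd ?h t" by auto
  have "?h t dvd a" if "g * a = ?h t * b" for a b
    by (rule P(3)[rule_format, of "?h t" a b]) (use h(2) that in auto)
  then show ?thesis by (rule that[OF g h(1)])
qed

section \<open>Graded pieces\<close>

lemma hom_part_add: "hom_part k (p + q) = hom_part k p + hom_part k q"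
  by (rule poly_mapping_eqI) (simp add: lookup_hom_part lookup_add)

lemma hom_part_sum: "hom_part k (sum g A) = (\<Sum>i\<in>A. hom_part k (g i))"
  by (rule poly_mapping_eqI) (simp add: lookup_hom_part lookup_sum)

lemma homogZ_hom_part: "homogZ k (hom_part k p)"
  by (auto simp: homogZ_def in_keys_iff lookup_hom_part split: if_splits)

lemma hom_part_homogZ: "homogZ j p \<Longrightarrow> hom_part k p = (if j = k then p else 0)"
  by (rule poly_mapping_eqI) (auto simp: homogZ_def in_keys_iff lookup_hom_part)

lemma hom_part_mult_homogZ:
  assumes q: "homogZ r q"
  shows "hom_part (k + r) (p * q) = hom_part k p * q"
proof (induction p rule: poly3_induct)
  case (single a b c e)
  let ?m = "Poly_Mapping.single (a, b, c) e"
  have m: "homogZ (int (mdeg (a, b, c))) ?m" by (auto simp: homogZ_def)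
  show ?case
    using hom_part_homogZ[OF m, of k] hom_part_homogZ[OF homogZ_mult[OF m q], of "k + r"] by simp
qed (simp add: hom_part_add algebra_simps)

section \<open>Hilbert functions of the polynomial ring and of free modules\<close>

definition forms :: "int \<Rightarrow> poly3 set" where
  "forms k = {p. homogZ k p}"

lemma subspace_forms: "P.subspace (forms k)"
  by (rule P.subspaceI) (auto simp: forms_def homogZ_add homogZ_cscale)

lemma mdeg_eq_image: "{m. mdeg m = n} = (\<lambda>(a, b). (a, b, n - a - b)) ` (SIGMA a : {..n}. {..n - a})"
  by (force simp: mdeg_def image_iff)

lemma finite_mdeg_eq: "finite {m. mdeg m = n}"
  by (simp add: mdeg_eq_image)

lemma card_mdeg_eq: "2 * card {m. mdeg m = n} = (n + 1) * (n + 2)"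
proof -
  have "card {m. mdeg m = n} = (\<Sum>a\<le>n. n - a + 1)"
    unfolding mdeg_eq_image by (subst card_image) (auto simp: inj_on_def)
  also have "\<dots> = (\<Sum>a\<le>n. a + 1)"
    by (rule sum.reindex_bij_witness[of _ "\<lambda>a. n - a" "\<lambda>a. n - a"]) auto
  also have "2 * \<dots> = (n + 1) * (n + 2)" by (induction n) auto
  finally show ?thesis .
qed

lemma cscale_single: "cscale c (Poly_Mapping.single m e) = Poly_Mapping.single m (c * e)"
  by (simp add: cscale_def mult_single flip: zero_prod_def)

lemma forms_basis:
  defines "B \<equiv> \<lambda>n. (\<lambda>m. Poly_Mapping.single m 1) ` {m. mdeg m = n} :: poly3 set"
  shows "finite (B n)" "P.independent (B n)" "B n \<subseteq> forms (int n)" "forms (int n) \<subseteq> P.span (B n)"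
    "card (B n) = card {m. mdeg m = n}"
proof -
  show "finite (B n)" by (simp add: B_def finite_mdeg_eq)
  have inj: "inj_on (\<lambda>m. Poly_Mapping.single m (1 :: complex)) A" for A :: "mono3 set"
    by (rule inj_onI) (metis lookup_single_eq lookup_single_not_eq zero_neq_one)
  then show "card (B n) = card {m. mdeg m = n}" by (simp add: B_def card_image)
  show "B n \<subseteq> forms (int n)" by (auto simp: B_def forms_def homogZ_def)
  show "P.independent (B n)"
  proof (rule P.independent_if_scalars_zero)
    fix g x assume *: "(\<Sum>x\<in>B n. cscale (g x) x) = 0" "x \<in> B n"
    then obtain m where m: "x = Poly_Mapping.single m 1" "mdeg m = n" by (auto simp: B_def)
    have "0 = Poly_Mapping.lookup (\<Sum>x\<in>B n. cscale (g x) x) m" using * by simp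
    also have "\<dots> = (\<Sum>l\<in>{m. mdeg m = n}. g (Poly_Mapping.single l 1) when l = m)"
      by (simp add: B_def sum.reindex[OF inj] lookup_sum cscale_single lookup_single)
    also have "\<dots> = g x" using m by (simp add: when_def finite_mdeg_eq)
    finally show "g x = 0" by simp
  qed (fact \<open>finite (B n)\<close>)
  show "forms (int n) \<subseteq> P.span (B n)"
  proof
    fix p assume p: "p \<in> forms (int n)"
    have "p = (\<Sum>m\<in>Poly_Mapping.keys p. cscale (Poly_Mapping.lookup p m) (Poly_Mapping.single m 1))"
      by (rule poly_mapping_eqI)
        (simp add: cscale_single lookup_sum lookup_single when_def not_in_keys_iff_lookup_eq_zero)
    moreover have "Poly_Mapping.single m 1 \<in> P.span (B n)" if "m \<in> Poly_Mapping.keys p" for m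
      using that p by (intro P.span_base) (auto simp: B_def forms_def homogZ_def)
    ultimately show "p \<in> P.span (B n)"
      by (metis (no_types, lifting) P.span_scale P.span_sum)
  qed
qed

lemma forms_neg: "k < 0 \<Longrightarrow> forms k = {0}"
  by (auto simp: forms_def homogZ_neg)

lemma finite_span_forms: obtains F where "finite F" "forms k \<subseteq> P.span F"
proof (cases "k < 0")
  case True
  then show ?thesis using that[of "{}"] by (simp add: forms_neg)
next
  case False
  then show ?thesis using that[OF forms_basis(1)[of "nat k"]] forms_basis(4)[of "nat k"] by simp
qed

definition sdim :: "int \<Rightarrow> int" where
  "sdim k = int (pdim (forms k))"

text \<open>Doubling avoids division. The closed form persists at -1 and -2, where both sides
  vanish, and fails from -3 downwards.\<close>

lemma sdim_eq: "k \<ge> -2 \<Longrightarrow> 2 * sdim k = (k + 1) * (k + 2)"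
proof (cases "k < 0")
  case True
  assume "k \<ge> -2"
  with True have "k = -1 \<or> k = -2" by auto
  then show ?thesis by (auto simp: sdim_def pdim_def forms_neg P.dim_zero)
next
  case False
  then obtain n where n: "k = int n" by (metis nonneg_int_cases not_less)
  have "P.dim (forms (int n)) = card {m. mdeg m = n}"
    by (rule P.dim_unique[OF forms_basis(3,4,2,5)])
  then show ?thesis
    using arg_cong[OF card_mdeg_eq[of n], of int] unfolding n sdim_def pdim_def by (simp add: algebra_simps)
qed

definition vforms :: "nat \<Rightarrow> int \<Rightarrow> vec3 set" where
  "vforms m k = {v. (\<forall>i\<ge>m. v i = 0) \<and> (\<forall>i. homogZ k (v i))}"

lemma subspace_vforms: "V.subspace (vforms m k)"
  by (rule V.subspaceI) (auto simp: vforms_def vscale_def homogZ_add homogZ_cscale)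

lemma finite_span_vforms: "\<exists>F. finite F \<and> vforms m k \<subseteq> V.span F"
proof (induction m)
  case 0
  have "vforms 0 k \<subseteq> {0}" by (auto simp: vforms_def)
  then show ?case by (intro exI[of _ "{}"]) simp
next
  case (Suc m)
  then obtain F where F: "finite F" "vforms m k \<subseteq> V.span F" by blast
  obtain G where G: "finite G" "forms k \<subseteq> P.span G" by (rule finite_span_forms)
  define e :: "poly3 \<Rightarrow> vec3" where "e p = (\<lambda>i. if i = m then p else 0)" for p
  have e: "module_hom cscale vscale e"
    by (simp add: module_hom_iff P.module_axioms V.module_axioms) (auto simp: e_def fun_eq_iff vscale_def)
  have "v \<in> V.span (F \<union> e ` G)" if v: "v \<in> vforms (Suc m) k" for v
  proof -
    have "v(m := 0) \<in> vforms m k" using v by (auto simp: vforms_def)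
    then have "v(m := 0) \<in> V.span (F \<union> e ` G)" using F V.span_mono[of F "F \<union> e ` G"] by auto
    moreover have "e (v m) \<in> e ` P.span G" using v G by (auto simp: vforms_def forms_def)
    then have "e (v m) \<in> V.span (F \<union> e ` G)"
      using module_hom.span_image[OF e, of G] V.span_mono[of "e ` G" "F \<union> e ` G"] by auto
    moreover have "v = v(m := 0) + e (v m)" by (auto simp: e_def)
    ultimately show ?thesis by (metis V.span_add)
  qed
  then show ?case using F(1) G(1) by (intro exI[of _ "F \<union> e ` G"]) auto
qed

lemma dim_vforms: "int (V.dim (vforms m k)) = int m * sdim k"
proof (induction m)
  case 0
  have "vforms 0 k = {0}" by (auto simp: vforms_def)
  then show ?case by (simp add: V.dim_zero)
next
  case (Suc m)
  obtain F where F: "finite F" "vforms (Suc m) k \<subseteq> V.span F" using finite_span_vforms by blast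
  have lin: "Vector_Spaces.linear vscale cscale (\<lambda>v. v m)"
    by (simp add: Vector_Spaces.linear_iff P.vector_space_axioms V.vector_space_axioms vscale_def)
  have "(\<lambda>v. v m) ` vforms (Suc m) k = forms k"
  proof
    show "forms k \<subseteq> (\<lambda>v. v m) ` vforms (Suc m) k"
    proof
      fix p assume "p \<in> forms k"
      then show "p \<in> (\<lambda>v. v m) ` vforms (Suc m) k"
        by (intro image_eqI[of _ _ "\<lambda>i. if i = m then p else 0"]) (auto simp: vforms_def forms_def)
    qed
  qed (auto simp: vforms_def forms_def)
  moreover have "{v \<in> vforms (Suc m) k. v m = 0} = vforms m k"
    by (auto simp: vforms_def not_less_eq_eq le_Suc_eq) (metis le_antisym not_less_eq_eq)
  ultimately show ?case
    using VP.rank_nullity[OF lin subspace_vforms F(2,1)] Suc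
    by (simp add: sdim_def pdim_def algebra_simps)
qed

section \<open>Graded submodules and multiplication by polynomials\<close>

definition pmul :: "poly3 \<Rightarrow> vec3 \<Rightarrow> vec3" where
  "pmul s v = (\<lambda>i. s * v i)"

definition submodule :: "vec3 set \<Rightarrow> bool" where
  "submodule M \<longleftrightarrow> 0 \<in> M \<and> (\<forall>u\<in>M. \<forall>v\<in>M. u + v \<in> M) \<and> (\<forall>s. \<forall>v\<in>M. pmul s v \<in> M)"

definition gpieceZ :: "vec3 set \<Rightarrow> int \<Rightarrow> vec3 set" where
  "gpieceZ M k = {v \<in> M. \<forall>i. homogZ k (v i)}"

lemma gpiece_eq: "gpiece M n = gpieceZ M (int n)"
  by (simp add: gpiece_def gpieceZ_def homog_iff_homogZ)

lemma vscale_pmul: "vscale c v = pmul (Poly_Mapping.single (0, 0, 0) c) v"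
  by (simp add: vscale_def pmul_def cscale_def)

lemma subspace_gpieceZ:
  assumes "submodule M"
  shows "V.subspace (gpieceZ M k)"
proof (rule V.subspaceI)
  show "vscale c v \<in> gpieceZ M k" if "v \<in> gpieceZ M k" for c v
    using that assms unfolding gpieceZ_def submodule_def
    by (auto simp: vscale_pmul) (metis homogZ_cscale vscale_def vscale_pmul)
qed (use assms in \<open>auto simp: gpieceZ_def submodule_def homogZ_add\<close>)

lemma linear_pmul: "Vector_Spaces.linear vscale vscale (pmul s)"
  by (simp add: Vector_Spaces.linear_iff V.vector_space_axioms)
    (auto simp: pmul_def vscale_def cscale_def fun_eq_iff algebra_simps)

lemma homogZ_var_mult_iff [simp]:
  "homogZ k (var_x * p) \<longleftrightarrow> homogZ (k - 1) p"
  "homogZ k (var_y * p) \<longleftrightarrow> homogZ (k - 1) p"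
  "homogZ k (var_z * p) \<longleftrightarrow> homogZ (k - 1) p"
proof -
  have *: "quot_x (var_x * p) = p" "quot_y (var_y * p) = p" "quot_z (var_z * p) = p"
    by (simp_all add: poly3_eq_iff lookup_quot lookup_var)
  show "homogZ k (var_x * p) \<longleftrightarrow> homogZ (k - 1) p"
    using homogZ_mult[OF homogZ_var(1), of "k - 1" p] homogZ_quot(1)[of k "var_x * p"]
    unfolding *(1) by (intro iffI) simp_all
  show "homogZ k (var_y * p) \<longleftrightarrow> homogZ (k - 1) p"
    using homogZ_mult[OF homogZ_var(2), of "k - 1" p] homogZ_quot(2)[of k "var_y * p"]
    unfolding *(2) by (intro iffI) simp_all
  show "homogZ k (var_z * p) \<longleftrightarrow> homogZ (k - 1) p"
    using homogZ_mult[OF homogZ_var(3), of "k - 1" p] homogZ_quot(3)[of k "var_z * p"]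
    unfolding *(3) by (intro iffI) simp_all
qed

section \<open>Generators of a graded module of maximal depth\<close>

definition hilb :: "vec3 set \<Rightarrow> int \<Rightarrow> int" where
  "hilb M k = int (cdim (gpieceZ M k))"

lemma gpieceZ_subset_vforms:
  assumes "M \<subseteq> {v. \<forall>i\<ge>m. v i = 0}"
  shows "gpieceZ M k \<subseteq> vforms m k"
  using assms by (auto simp: gpieceZ_def vforms_def)

lemma pmul_pmul: "pmul s (pmul t v) = pmul (s * t) v"
  by (simp add: pmul_def mult.assoc)

lemma pmul_in_gpieceZ:
  assumes "submodule M" "v \<in> gpieceZ M k" "homogZ j s"
  shows "pmul s v \<in> gpieceZ M (j + k)"
  using assms by (auto simp: gpieceZ_def submodule_def pmul_def homogZ_mult)

lemma pmul_eq_0_iff: "pmul s v = 0 \<longleftrightarrow> s = 0 \<or> v = 0"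
  by (auto simp: pmul_def fun_eq_iff)

lemma cdim_pmul_image:
  assumes "V.subspace U" "U \<subseteq> V.span F" "finite F" "s \<noteq> 0"
  shows "cdim (pmul s ` U) = cdim U"
  using VV.dim_inj_image[OF linear_pmul assms(1-3), of s] assms(4) by (auto simp: cdim_def pmul_eq_0_iff)

lemma var_neq_0: "var_x \<noteq> 0" "var_y \<noteq> 0" "var_z \<noteq> 0"
  using var_eq_0[of 1] by auto

text \<open>Inclusion-exclusion for \<open>x M + y M + z M\<close>. Multiplication by a nonzero
  polynomial is injective inside a free module; \<open>reg_y\<close> and \<open>reg_z\<close> say
  that y is regular modulo x, and z modulo x and y, on \<open>M\<close>. They identify the two
  intersections that occur, \<open>x M\<close> with \<open>y M\<close> and \<open>x M + y M\<close>
  with \<open>z M\<close>, as \<open>x y M\<close> and \<open>z (x M + y M)\<close>.\<close>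

lemma third_difference:
  assumes M: "submodule M" "M \<subseteq> {v. \<forall>i\<ge>m. v i = 0}"
    and reg_y: "\<And>k a b. a \<in> gpieceZ M k \<Longrightarrow> b \<in> gpieceZ M k \<Longrightarrow> pmul var_y a = pmul var_x b \<Longrightarrow>
      \<exists>a'\<in>gpieceZ M (k - 1). a = pmul var_x a'"
    and reg_z: "\<And>k a b c. a \<in> gpieceZ M k \<Longrightarrow> b \<in> gpieceZ M k \<Longrightarrow> c \<in> gpieceZ M k \<Longrightarrow>
      pmul var_z a = pmul var_x b + pmul var_y c \<Longrightarrow>
      \<exists>a'\<in>gpieceZ M (k - 1). \<exists>a''\<in>gpieceZ M (k - 1). a = pmul var_x a' + pmul var_y a''"
  shows "int (num_gens M n) =
    hilb M n - 3 * hilb M (int n - 1) + 3 * hilb M (int n - 2) - hilb M (int n - 3)"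
proof -
  define N where "N = gpieceZ M"
  have subN: "V.subspace (N k)" for k unfolding N_def by (rule subspace_gpieceZ[OF M(1)])
  have finN: "\<exists>F. finite F \<and> N k \<subseteq> V.span F" for k
    using finite_span_vforms[of m k] gpieceZ_subset_vforms[OF M(2)] unfolding N_def by blast
  have mulN: "pmul s v \<in> N k" if "homogZ 1 s" "v \<in> N (k - 1)" for s v k
    using pmul_in_gpieceZ[OF M(1) that(2)[unfolded N_def] that(1)] by (simp add: N_def)
  have sub_im: "V.subspace (pmul s ` U)" if "V.subspace U" for s U
    by (rule VV.linear_subspace_image[OF linear_pmul that])
  define X where "X k = pmul var_x ` N (k - 1)" for k
  define Y where "Y k = pmul var_y ` N (k - 1)" for k
  define Z where "Z k = pmul var_z ` N (k - 1)" for k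
  have subXYZ: "V.subspace (X k)" "V.subspace (Y k)" "V.subspace (Z k)" for k
    unfolding X_def Y_def Z_def by (intro sub_im subN)+
  have inXYZ: "X k \<subseteq> N k" "Y k \<subseteq> N k" "Z k \<subseteq> N k" for k
    unfolding X_def Y_def Z_def using mulN by auto
  have dN: "hilb M k = int (cdim (N k))" for k by (simp add: hilb_def N_def)
  have dim_im: "cdim (pmul s ` N k) = cdim (N k)" if "s \<noteq> 0" for s k
    using cdim_pmul_image[OF subN _ _ that] finN by blast
  define XY where "XY k = {u + v | u v. u \<in> X k \<and> v \<in> Y k}" for k
  have subXY: "V.subspace (XY k)" for k unfolding XY_def by (intro V.subspace_sums subXYZ)
  have addN: "u + v \<in> N k" if "u \<in> N k" "v \<in> N k" for u v k using V.subspace_add[OF subN] that .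
  have inXY: "XY k \<subseteq> N k" for k
    unfolding XY_def using inXYZ addN by blast
  \<comment> \<open>The nontrivial inclusion is \<open>reg_y\<close>.\<close>
  have "X k \<inter> Y k = pmul (var_x * var_y) ` N (k - 2)" for k
  proof (intro equalityI subsetI)
    fix v assume "v \<in> X k \<inter> Y k"
    then obtain b a where v: "v = pmul var_x b" "b \<in> N (k - 1)" "v = pmul var_y a" "a \<in> N (k - 1)"
      unfolding X_def Y_def by blast
    then obtain a' where "a' \<in> N (k - 2)" "a = pmul var_x a'"
      using reg_y[of a "k - 1" b] by (auto simp: N_def)
    then have "v = pmul (var_x * var_y) a'" using v(3) by (simp add: pmul_pmul mult.commute)
    then show "v \<in> pmul (var_x * var_y) ` N (k - 2)" using \<open>a' \<in> N (k - 2)\<close> by blast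
  next
    fix v assume "v \<in> pmul (var_x * var_y) ` N (k - 2)"
    then obtain a where a: "a \<in> N (k - 2)" "v = pmul var_x (pmul var_y a)" "v = pmul var_y (pmul var_x a)"
      by (auto simp: pmul_pmul mult.commute)
    then have "pmul var_y a \<in> N (k - 1)" "pmul var_x a \<in> N (k - 1)" by (auto intro: mulN)
    then show "v \<in> X k \<inter> Y k" using a(2,3) unfolding X_def Y_def by blast
  qed
  then have dXY: "int (cdim (XY k)) = 2 * hilb M (k - 1) - hilb M (k - 2)" for k
  proof -
    obtain F where F: "finite F" "N k \<subseteq> V.span F" using finN by blast
    have "cdim (XY k) + cdim (X k \<inter> Y k) = cdim (X k) + cdim (Y k)"
      unfolding cdim_def XY_def
      using inXYZ[of k] F by (intro V.dim_sum_Int[OF subXYZ(1) _ subXYZ(2), of _ F]) auto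
    moreover have "cdim (X k) = cdim (N (k - 1))" "cdim (Y k) = cdim (N (k - 1))"
      unfolding X_def Y_def using var_neq_0 by (simp_all add: dim_im)
    moreover have "cdim (X k \<inter> Y k) = cdim (N (k - 2))"
      unfolding \<open>\<And>k. X k \<inter> Y k = pmul (var_x * var_y) ` N (k - 2)\<close>
      using var_neq_0 by (simp add: dim_im)
    ultimately show ?thesis by (simp add: dN)
  qed
  define T where "T k = {u + v | u v. u \<in> XY k \<and> v \<in> Z k}" for k
  have subT: "V.subspace (T k)" for k unfolding T_def by (intro V.subspace_sums subXYZ subXY)
  have inT: "T k \<subseteq> N k" for k
    unfolding T_def using inXYZ inXY addN by blast
  \<comment> \<open>The nontrivial inclusion is \<open>reg_z\<close>; since \<open>XY\<close> is
    already measured, its shift by one degree supplies the dimension of the intersection.\<close>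
  have "XY k \<inter> Z k = pmul var_z ` XY (k - 1)" for k
  proof (intro equalityI subsetI)
    fix v assume "v \<in> XY k \<inter> Z k"
    then obtain a b c where v: "v = pmul var_z a" "v = pmul var_x b + pmul var_y c"
      "a \<in> N (k - 1)" "b \<in> N (k - 1)" "c \<in> N (k - 1)"
      unfolding XY_def X_def Y_def Z_def by blast
    then obtain a' a'' where "a' \<in> N (k - 1 - 1)" "a'' \<in> N (k - 1 - 1)" "a = pmul var_x a' + pmul var_y a''"
      using reg_z[of a "k - 1" b c] unfolding N_def by metis
    then have "a \<in> XY (k - 1)" unfolding XY_def X_def Y_def by blast
    then show "v \<in> pmul var_z ` XY (k - 1)" using v by blast
  next
    fix v assume "v \<in> pmul var_z ` XY (k - 1)"
    then obtain a b where ab: "v = pmul var_z (pmul var_x a + pmul var_y b)" "a \<in> N (k - 2)" "b \<in> N (k - 2)"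
      by (auto simp: XY_def X_def Y_def)
    then have "v = pmul var_x (pmul var_z a) + pmul var_y (pmul var_z b)"
      by (simp add: pmul_def algebra_simps fun_eq_iff)
    moreover have "pmul var_z a \<in> N (k - 1)" "pmul var_z b \<in> N (k - 1)" using ab by (auto intro: mulN)
    ultimately have "v \<in> XY k" unfolding XY_def X_def Y_def by blast
    moreover have "v \<in> Z k" using ab(1) inXY[of "k - 1"] \<open>v \<in> pmul var_z ` XY (k - 1)\<close> by (auto simp: Z_def)
    ultimately show "v \<in> XY k \<inter> Z k" by blast
  qed
  then have dT: "int (cdim (T k)) = 3 * hilb M (k - 1) - 3 * hilb M (k - 2) + hilb M (k - 3)" for k
  proof -
    obtain F where F: "finite F" "N k \<subseteq> V.span F" using finN by blast
    obtain F' where F': "finite F'" "N (k - 1) \<subseteq> V.span F'" using finN by blast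
    have "cdim (T k) + cdim (XY k \<inter> Z k) = cdim (XY k) + cdim (Z k)"
      unfolding cdim_def T_def
      using inXYZ[of k] inXY[of k] F by (intro V.dim_sum_Int[OF subXY _ subXYZ(3), of _ F]) auto
    moreover have "cdim (Z k) = cdim (N (k - 1))"
      unfolding Z_def using var_neq_0 by (simp add: dim_im)
    moreover have "cdim (XY k \<inter> Z k) = cdim (XY (k - 1))"
      unfolding \<open>\<And>k. XY k \<inter> Z k = pmul var_z ` XY (k - 1)\<close>
      using var_neq_0 F' inXY[of "k - 1"] by (intro cdim_pmul_image[OF subXY, of _ F']) auto
    ultimately show ?thesis using dXY[of k] dXY[of "k - 1"] by (simp add: dN)
  qed
  \<comment> \<open>\<open>decomp_piece\<close> collects single products, not their sums; as
    \<open>dim\<close> depends only on the span, it is enough to compare spans.\<close>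
  have "cdim (decomp_piece M n) = cdim (T n)"
    unfolding cdim_def
  proof (rule V.span_eq_dim, rule V.span_eq[THEN iffD2], rule conjI)
    have "decomp_piece M n \<subseteq> T n"
    proof
      fix w assume "w \<in> decomp_piece M n"
      then obtain s v j where w: "w = pmul s v" "1 \<le> j" "j \<le> n" "homogZ (int j) s" "v \<in> N (int n - int j)"
        by (auto simp: decomp_piece_def pmul_def N_def gpiece_eq homog_iff_homogZ)
      then obtain s1 s2 s3 where s: "homogZ (int j - 1) s1" "homogZ (int j - 1) s2" "homogZ (int j - 1) s3"
        "s = var_x * s1 + var_y * s2 + var_z * s3"
        using homogZ_split[of "int j" s] by auto
      have "pmul s' v \<in> N (int n - 1)" if "homogZ (int j - 1) s'" for s'
        using pmul_in_gpieceZ[OF M(1) w(5)[unfolded N_def] that] by (simp add: N_def)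
      with s have "pmul s1 v \<in> N (int n - 1)" "pmul s2 v \<in> N (int n - 1)" "pmul s3 v \<in> N (int n - 1)" by blast+
      moreover have "w = pmul var_x (pmul s1 v) + pmul var_y (pmul s2 v) + pmul var_z (pmul s3 v)"
        using w s by (simp add: pmul_def algebra_simps fun_eq_iff)
      ultimately show "w \<in> T n" unfolding T_def XY_def X_def Y_def Z_def by blast
    qed
    then show "decomp_piece M n \<subseteq> V.span (T n)" using V.span_superset by blast
    have var: "pmul s v \<in> V.span (decomp_piece M n)" if "homogZ 1 s" "v \<in> N (int n - 1)" for s v
    \<comment> \<open>In degree 0 \<open>decomp_piece\<close> is empty, but then \<open>v\<close>
      has degree -1 and vanishes.\<close>
    proof (cases "n = 0")
      case True
      then have "v = 0" using that by (auto simp: N_def gpieceZ_def homogZ_neg)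
      then have "pmul s v = 0" by (simp add: pmul_eq_0_iff)
      then show ?thesis by (simp add: V.span_zero)
    next
      case False
      then have "pmul s v \<in> decomp_piece M n"
        using that unfolding decomp_piece_def gpiece_eq pmul_def N_def
        by (auto simp: homog_iff_homogZ intro!: exI[of _ s] exI[of _ v] exI[of _ "1::nat"])
      then show ?thesis by (rule V.span_base)
    qed
    show "T n \<subseteq> V.span (decomp_piece M n)"
      unfolding T_def XY_def X_def Y_def Z_def by (auto intro!: V.span_add var)
  qed
  moreover obtain F where F: "finite F" "N n \<subseteq> V.span F" using finN by blast
  \<comment> \<open>Makes the natural-number subtraction in \<open>num_gens\<close> exact.\<close>
  then have "cdim (T n) \<le> cdim (N n)" unfolding cdim_def by (intro V.dim_mono_finite[OF inT F(2,1)])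
  ultimately show ?thesis
    using dT[of n] by (simp add: num_gens_def gpiece_eq dN flip: N_def)
qed

section \<open>Logarithmic derivations and their syzygies\<close>

text \<open>\<open>grad_dot\<close> and \<open>gen_comb\<close> are the maps \<open>S^3 -> S\<close>
  and \<open>S^m -> S^3\<close> of the resolution; their kernels are \<open>D0 f\<close> and
  \<open>syz m \<rho>\<close>.\<close>

definition grad_dot :: "poly3 \<Rightarrow> vec3 \<Rightarrow> poly3" where
  "grad_dot f v = v 0 * dx f + v 1 * dy f + v 2 * dz f"

definition gen_comb :: "nat \<Rightarrow> (nat \<Rightarrow> vec3) \<Rightarrow> vec3 \<Rightarrow> vec3" where
  "gen_comb m \<rho> c = (\<lambda>i. \<Sum>j<m. c j * \<rho> j i)"

lemma D0_iff: "v \<in> D0 f \<longleftrightarrow> (\<forall>i\<ge>3. v i = 0) \<and> grad_dot f v = 0"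
  by (simp add: D0_def grad_dot_def)

lemma syz_iff: "c \<in> syz m \<rho> \<longleftrightarrow> (\<forall>j\<ge>m. c j = 0) \<and> gen_comb m \<rho> c = 0"
  by (simp add: syz_def gen_comb_def zero_fun_def)

lemma grad_dot_add: "grad_dot f (u + v) = grad_dot f u + grad_dot f v"
  and grad_dot_pmul: "grad_dot f (pmul s v) = s * grad_dot f v"
  and grad_dot_0: "grad_dot f 0 = 0"
  by (simp_all add: grad_dot_def pmul_def algebra_simps)

lemma gen_comb_add: "gen_comb m \<rho> (u + v) = gen_comb m \<rho> u + gen_comb m \<rho> v"
  by (simp add: gen_comb_def algebra_simps sum.distrib fun_eq_iff)

lemma gen_comb_pmul: "gen_comb m \<rho> (pmul s v) = pmul s (gen_comb m \<rho> v)"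
  by (simp add: gen_comb_def pmul_def sum_distrib_left fun_eq_iff mult.assoc)

lemma gen_comb_0: "gen_comb m \<rho> 0 = 0"
  by (simp add: gen_comb_def fun_eq_iff)

lemma gen_comb_diff: "gen_comb m \<rho> (u - v) = gen_comb m \<rho> u - gen_comb m \<rho> v"
  by (simp add: gen_comb_def algebra_simps sum_subtractf fun_eq_iff)

lemma grad_dot_gen_comb: "grad_dot f (gen_comb m \<rho> c) = (\<Sum>j<m. c j * grad_dot f (\<rho> j))"
  by (simp add: grad_dot_def gen_comb_def sum_distrib_right sum_distrib_left sum.distrib algebra_simps)

lemma submodule_syz: "submodule (syz m \<rho>)"
  by (auto simp: submodule_def syz_iff gen_comb_add gen_comb_pmul gen_comb_0) (simp_all add: pmul_def fun_eq_iff)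

lemma linear_grad_dot: "Vector_Spaces.linear vscale cscale (grad_dot f)"
  by (simp add: Vector_Spaces.linear_iff V.vector_space_axioms P.vector_space_axioms grad_dot_add
      vscale_pmul grad_dot_pmul cscale_def)

lemma linear_gen_comb: "Vector_Spaces.linear vscale vscale (gen_comb m \<rho>)"
  by (simp add: Vector_Spaces.linear_iff V.vector_space_axioms gen_comb_add vscale_pmul gen_comb_pmul)

text \<open>Rank-nullity for \<open>grad_dot\<close> on triples of degree \<open>k\<close>: the
  kernel is a piece of \<open>D0 f\<close>, the image the piece of the Jacobian ideal in degree
  \<open>k + (d - 1)\<close>.\<close>

lemma hilb_D0:
  assumes "0 < d"
  shows "hilb (D0 f) (int k) + int (pdim (jac_piece d f (k + (d - 1)))) = 3 * sdim (int k)"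
proof -
  obtain F where F: "finite F" "vforms 3 (int k) \<subseteq> V.span F" using finite_span_vforms by blast
  have "{v \<in> vforms 3 (int k). grad_dot f v = 0} = gpieceZ (D0 f) (int k)"
    by (auto simp: vforms_def gpieceZ_def D0_iff)
  moreover have "grad_dot f ` vforms 3 (int k) = jac_piece d f (k + (d - 1))"
  proof (intro equalityI subsetI)
    fix p assume "p \<in> grad_dot f ` vforms 3 (int k)"
    then show "p \<in> jac_piece d f (k + (d - 1))"
      using assms by (auto simp: jac_piece_def grad_dot_def vforms_def homog_iff_homogZ) blast
  next
    fix p assume "p \<in> jac_piece d f (k + (d - 1))"
    then obtain a b c where p: "p = a * dx f + b * dy f + c * dz f" "homogZ k a" "homogZ k b" "homogZ k c"
      using assms by (auto simp: jac_piece_def homog_iff_homogZ)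
    then show "p \<in> grad_dot f ` vforms 3 (int k)"
      by (intro image_eqI[of _ _ "\<lambda>i. if i = 0 then a else if i = 1 then b else if i = 2 then c else 0"])
        (auto simp: grad_dot_def vforms_def)
  qed
  ultimately show ?thesis
    using VP.rank_nullity[OF linear_grad_dot[of f] subspace_vforms F(2,1)] dim_vforms[of 3 "int k"]
    by (simp add: hilb_def pdim_def cdim_def)
qed

text \<open>\<open>submod_gen\<close> allows any finite index set, on which a generator may recur;
  induction on that set collects the coefficients over the indices below \<open>m\<close>.\<close>

lemma gen_comb_surj:
  assumes gen: "submod_gen (\<rho> ` {..<m}) = D0 f" and w: "w \<in> D0 f"
  obtains c where "w = gen_comb m \<rho> c"
proof -
  from w[folded gen] obtain A c g where w: "w = (\<lambda>i. \<Sum>j\<in>A. c j * g j i)" "finite (A :: nat set)"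
    "g ` A \<subseteq> \<rho> ` {..<m}" by (auto simp: submod_gen_def)
  have "\<exists>c'. (\<Sum>j\<in>A. pmul (c j) (g j)) = gen_comb m \<rho> c'"
    using w(2,3)
  proof (induction A rule: finite_induct)
    case empty
    show ?case using gen_comb_0[of m \<rho>] by (intro exI[of _ 0]) (simp only: sum.empty)
  next
    case (insert j A)
    then obtain c' where c': "(\<Sum>j\<in>A. pmul (c j) (g j)) = gen_comb m \<rho> c'" by auto
    from insert obtain l where l: "l < m" "g j = \<rho> l" by auto
    have "pmul (c j) (g j) = gen_comb m \<rho> (\<lambda>i. if i = l then c j else 0)"
      using l by (simp add: gen_comb_def pmul_def if_distrib[of "\<lambda>p. p * _"] cong: if_cong)
    then have "(\<Sum>j\<in>insert j A. pmul (c j) (g j)) = gen_comb m \<rho> ((\<lambda>i. if i = l then c j else 0) + c')"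
      using insert.hyps c' by (simp add: gen_comb_add)
    then show ?case by blast
  qed
  moreover have "w = (\<Sum>j\<in>A. pmul (c j) (g j))"
    using w(2) unfolding w(1) by (induction A rule: finite_induct) (auto simp: fun_eq_iff pmul_def)
  ultimately show ?thesis using that by auto
qed

text \<open>All generators have the same degree \<open>r\<close>, so only the
  degree-\<open>k\<close> components of the coefficients contribute to \<open>w\<close>.\<close>

lemma gen_comb_surj_graded:
  assumes gen: "submod_gen (\<rho> ` {..<m}) = D0 f" and \<rho>: "\<And>j i. j < m \<Longrightarrow> homogZ r (\<rho> j i)"
    and w: "w \<in> gpieceZ (D0 f) (k + r)"
  obtains c where "w = gen_comb m \<rho> c" "c \<in> vforms m k"
proof -
  obtain c where c: "w = gen_comb m \<rho> c"
    using gen_comb_surj[OF gen] w by (auto simp: gpieceZ_def)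
  show ?thesis
  proof
    let ?c = "\<lambda>j. if j < m then hom_part k (c j) else 0"
    show "?c \<in> vforms m k" by (auto simp: vforms_def homogZ_hom_part)
    show "w = gen_comb m \<rho> ?c"
    proof
      fix i
      have "w i = hom_part (k + r) (w i)" using w hom_part_homogZ[of "k + r" "w i" "k + r"] by (simp add: gpieceZ_def)
      also have "\<dots> = (\<Sum>j<m. hom_part (k + r) (c j * \<rho> j i))" by (simp add: c gen_comb_def hom_part_sum)
      also have "\<dots> = gen_comb m \<rho> ?c i" by (simp add: gen_comb_def hom_part_mult_homogZ[OF \<rho>])
      finally show "w i = gen_comb m \<rho> ?c i" .
    qed
  qed
qed

lemma homogZ_gen_comb:
  assumes "\<And>j i. j < m \<Longrightarrow> homogZ r (\<rho> j i)" "\<And>j. homogZ k (c j)"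
  shows "homogZ (k + r) (gen_comb m \<rho> c i)"
  unfolding gen_comb_def by (intro homogZ_sum homogZ_mult assms) auto

lemma gen_comb_in_D0:
  assumes "\<And>j. j < m \<Longrightarrow> \<rho> j \<in> D0 f"
  shows "gen_comb m \<rho> c \<in> D0 f"
  using assms by (simp add: D0_iff grad_dot_gen_comb) (simp add: gen_comb_def)

text \<open>Rank-nullity for \<open>gen_comb\<close>, which raises degrees by \<open>r\<close>: the
  degree of a syzygy is that of its coefficients.\<close>

lemma hilb_syz:
  assumes gen: "submod_gen (\<rho> ` {..<m}) = D0 f" and \<rho>: "\<And>j i. j < m \<Longrightarrow> homogZ r (\<rho> j i)"
    and \<rho>D: "\<And>j. j < m \<Longrightarrow> \<rho> j \<in> D0 f"
  shows "hilb (syz m \<rho>) k + hilb (D0 f) (k + r) = int m * sdim k"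
proof -
  obtain F where F: "finite F" "vforms m k \<subseteq> V.span F" using finite_span_vforms by blast
  have "{v \<in> vforms m k. gen_comb m \<rho> v = 0} = gpieceZ (syz m \<rho>) k"
    by (auto simp: vforms_def gpieceZ_def syz_iff)
  moreover have "gen_comb m \<rho> ` vforms m k = gpieceZ (D0 f) (k + r)"
  proof (intro equalityI subsetI)
    fix w assume "w \<in> gen_comb m \<rho> ` vforms m k"
    then show "w \<in> gpieceZ (D0 f) (k + r)"
      using gen_comb_in_D0[of m \<rho> f, OF \<rho>D] homogZ_gen_comb[of m r \<rho>, OF \<rho>]
      by (auto simp: gpieceZ_def vforms_def)
  next
    fix w assume "w \<in> gpieceZ (D0 f) (k + r)"
    then show "w \<in> gen_comb m \<rho> ` vforms m k" using gen_comb_surj_graded[OF gen \<rho>] by blast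
  qed
  ultimately show ?thesis
    using VV.rank_nullity[OF linear_gen_comb[of m \<rho>] subspace_vforms F(2,1)] dim_vforms[of m k]
    by (simp add: hilb_def cdim_def)
qed

text \<open>Divisibility by \<open>var_x\<close> holds coordinatewise in the free module, and the
  quotient is again a syzygy because the target of \<open>gen_comb\<close> has no torsion.\<close>

lemma syz_reg_y:
  assumes "a \<in> gpieceZ (syz m \<rho>) k" "pmul var_y a = pmul var_x b"
  shows "\<exists>a'\<in>gpieceZ (syz m \<rho>) (k - 1). a = pmul var_x a'"
proof
  let ?a = "\<lambda>j. quot_x (a j)"
  have "a j = var_x * ?a j" for j
    using var_x_regular[of "a j" "b j"] fun_cong[OF assms(2), of j] by (simp add: pmul_def)
  then show a: "a = pmul var_x ?a" by (simp add: pmul_def fun_eq_iff)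
  have "gen_comb m \<rho> a = 0" using assms(1) by (simp add: gpieceZ_def syz_iff)
  then have "pmul var_x (gen_comb m \<rho> ?a) = 0" by (subst (asm) a) (simp add: gen_comb_pmul)
  then have "gen_comb m \<rho> ?a = 0" using var_neq_0 by (simp add: pmul_eq_0_iff)
  then show "?a \<in> gpieceZ (syz m \<rho>) (k - 1)"
    using assms(1) by (simp add: gpieceZ_def syz_iff homogZ_quot)
qed

text \<open>Write \<open>a = x a1 + y a2\<close> over the polynomial ring. Applying the presentation map \<open>\<phi>\<close> to this
  and cancelling gives \<open>\<phi> a1 = y w\<close> and \<open>\<phi> a2 = - x w\<close> with \<open>w\<close> in \<open>D0 f\<close>, so \<open>w = \<phi> v\<close>, and
  \<open>a1 - y v\<close>, \<open>a2 + x v\<close> are syzygies.\<close>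

lemma syz_reg_z:
  assumes gen: "submod_gen (\<rho> ` {..<m}) = D0 f" and \<rho>: "\<And>j i. j < m \<Longrightarrow> homogZ r (\<rho> j i)"
    and \<rho>D: "\<And>j. j < m \<Longrightarrow> \<rho> j \<in> D0 f"
    and a: "a \<in> gpieceZ (syz m \<rho>) k" and eq: "pmul var_z a = pmul var_x b + pmul var_y c"
  shows "\<exists>a'\<in>gpieceZ (syz m \<rho>) (k - 1). \<exists>a''\<in>gpieceZ (syz m \<rho>) (k - 1). a = pmul var_x a' + pmul var_y a''"
proof -
  define a1 where "a1 = (\<lambda>j. quot_x (a j))"
  define a2 where "a2 = (\<lambda>j. quot_y (a j - var_x * quot_x (a j)))"
  have "a j = var_x * a1 j + var_y * a2 j" for j
    using var_z_regular[of "a j" "b j" "c j"] fun_cong[OF eq, of j] by (simp add: pmul_def a1_def a2_def)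
  then have a_eq: "a = pmul var_x a1 + pmul var_y a2" by (simp add: pmul_def fun_eq_iff)
  have ha: "homogZ k (a j)" "j \<ge> m \<Longrightarrow> a j = 0" for j using a by (simp_all add: gpieceZ_def syz_iff)
  have h: "a1 \<in> vforms m (k - 1)" "a2 \<in> vforms m (k - 1)"
    using ha by (auto simp: vforms_def a1_def a2_def homogZ_quot intro!: homogZ_quot homogZ_diff)
  let ?\<phi> = "gen_comb m \<rho>"
  have "?\<phi> a = 0" using a by (simp add: gpieceZ_def syz_iff)
  then have "pmul var_x (?\<phi> a1) + pmul var_y (?\<phi> a2) = 0"
    by (subst (asm) a_eq) (simp add: gen_comb_add gen_comb_pmul)
  then have sum0: "var_x * ?\<phi> a1 i + var_y * ?\<phi> a2 i = 0" for i by (simp add: pmul_def fun_eq_iff)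
  define w where "w = (\<lambda>i. quot_y (?\<phi> a1 i))"
  have w1: "?\<phi> a1 i = var_y * w i" for i
    unfolding w_def
    by (rule var_y_regular[of _ "- ?\<phi> a2 i"]) (use sum0[of i] in \<open>simp add: add_eq_0_iff2\<close>)
  have w2: "?\<phi> a2 i = - (var_x * w i)" for i
  proof -
    have "var_y * (?\<phi> a2 i + var_x * w i) = 0" using sum0[of i] by (simp add: w1 algebra_simps)
    then show ?thesis by (simp add: var_neq_0 eq_neg_iff_add_eq_0)
  qed
  have \<phi>1: "?\<phi> a1 = pmul var_y w" and \<phi>2: "?\<phi> a2 = - pmul var_x w"
    using w1 w2 by (simp_all add: pmul_def fun_eq_iff)
  have "?\<phi> a1 \<in> D0 f" by (rule gen_comb_in_D0[OF \<rho>D])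
  then have "w \<in> D0 f"
    using var_neq_0 by (simp add: \<phi>1 D0_iff grad_dot_pmul) (simp add: pmul_def)
  moreover have "homogZ (k - 1 + r) (?\<phi> a1 i)" for i
    using h by (intro homogZ_gen_comb \<rho>) (auto simp: vforms_def)
  then have "homogZ (k - 2 + r) (w i)" for i by (simp add: w1 algebra_simps)
  ultimately have "w \<in> gpieceZ (D0 f) (k - 2 + r)" by (simp add: gpieceZ_def)
  then obtain v where v: "w = ?\<phi> v" "v \<in> vforms m (k - 2)" using gen_comb_surj_graded[OF gen \<rho>] by blast
  have "?\<phi> (a1 - pmul var_y v) = 0" "?\<phi> (a2 + pmul var_x v) = 0"
    by (simp_all add: gen_comb_diff gen_comb_add gen_comb_pmul \<phi>1 \<phi>2 v(1))
  moreover have "homogZ (k - 1) ((a1 - pmul var_y v) j)" "homogZ (k - 1) ((a2 + pmul var_x v) j)" for j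
    using h v(2) by (auto simp: vforms_def pmul_def intro!: homogZ_add homogZ_diff)
  moreover have "(a1 - pmul var_y v) j = 0" "(a2 + pmul var_x v) j = 0" if "j \<ge> m" for j
    using h v(2) that by (auto simp: vforms_def pmul_def)
  ultimately have "a1 - pmul var_y v \<in> gpieceZ (syz m \<rho>) (k - 1)" "a2 + pmul var_x v \<in> gpieceZ (syz m \<rho>) (k - 1)"
    unfolding gpieceZ_def syz_iff by blast+
  moreover have "a = pmul var_x (a1 - pmul var_y v) + pmul var_y (a2 + pmul var_x v)"
    by (simp add: a_eq pmul_def fun_eq_iff algebra_simps)
  ultimately show ?thesis by blast
qed

lemma num_gens_syz:
  assumes "submod_gen (\<rho> ` {..<m}) = D0 f" "\<And>j i. j < m \<Longrightarrow> homogZ r (\<rho> j i)" "\<And>j. j < m \<Longrightarrow> \<rho> j \<in> D0 f"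
  shows "int (num_gens (syz m \<rho>) n) = hilb (syz m \<rho>) n - 3 * hilb (syz m \<rho>) (int n - 1) +
    3 * hilb (syz m \<rho>) (int n - 2) - hilb (syz m \<rho>) (int n - 3)"
proof (rule third_difference[OF submodule_syz])
  show "syz m \<rho> \<subseteq> {v. \<forall>i\<ge>m. v i = 0}" by (auto simp: syz_iff)
qed (use syz_reg_y syz_reg_z[of \<rho> m f r, OF assms] in blast)+

lemma hilb_neg: "submodule M \<Longrightarrow> k < 0 \<Longrightarrow> hilb M k = 0"
proof -
  assume "submodule M" "k < 0"
  then have "gpieceZ M k = {0}" by (auto simp: gpieceZ_def homogZ_neg submodule_def fun_eq_iff)
  then show ?thesis by (simp add: hilb_def cdim_def V.dim_zero)
qed

text \<open>A nonzero syzygy of degree 0 has constant coefficients and would express one generator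
  through the others, against minimality.\<close>

lemma hilb_syz_0:
  assumes min: "\<And>j. j < m \<Longrightarrow> \<rho> j \<notin> submod_gen (\<rho> ` ({..<m} - {j}))"
  shows "hilb (syz m \<rho>) 0 = 0"
proof -
  have "c = 0" if c: "c \<in> gpieceZ (syz m \<rho>) 0" for c
  proof (rule ccontr)
    assume "c \<noteq> 0"
    then obtain j where j: "c j \<noteq> 0" by (auto simp: fun_eq_iff)
    with c have jm: "j < m" by (auto simp: gpieceZ_def syz_iff not_less[symmetric])
    have "c j = Poly_Mapping.single (0, 0, 0) (Poly_Mapping.lookup (c j) (0, 0, 0))" (is "_ = _ _ ?e")
      using c by (intro poly3_eqI) (force simp: gpieceZ_def homogZ_iff lookup_single when_def)
    then obtain e where e: "c j = Poly_Mapping.single (0, 0, 0) e" by blast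
    with j have "e \<noteq> 0" by auto
    then have inv: "Poly_Mapping.single (0, 0, 0) (- (1 / e)) * c j = - 1"
      by (simp add: e mult_single single_uminus flip: zero_prod_def)
    \<comment> \<open>Scaling by \<open>- 1 / e\<close> turns the coefficient of
      \<open>\<rho> j\<close> into -1, so the relation can be read as a formula for
      \<open>\<rho> j\<close>.\<close>
    let ?s = "Poly_Mapping.single (0, 0, 0) (- (1 / e)) :: poly3"
    have "\<rho> j i = (\<Sum>l\<in>{..<m} - {j}. ?s * c l * \<rho> l i)" for i
    proof -
      have "0 = ?s * gen_comb m \<rho> c i" using c by (simp add: gpieceZ_def syz_iff)
      also have "\<dots> = (\<Sum>l<m. ?s * c l * \<rho> l i)" by (simp add: gen_comb_def sum_distrib_left mult.assoc)
      also have "\<dots> = ?s * c j * \<rho> j i + (\<Sum>l\<in>{..<m} - {j}. ?s * c l * \<rho> l i)"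
        using jm by (subst sum.remove[of _ j]) auto
      finally show ?thesis unfolding inv by (simp add: eq_neg_iff_add_eq_0)
    qed
    then have "\<rho> j = (\<lambda>i. \<Sum>l\<in>{..<m} - {j}. (?s * c l) * \<rho> l i)" by blast
    then have "\<rho> j \<in> submod_gen (\<rho> ` ({..<m} - {j}))"
      unfolding submod_gen_def by (intro CollectI exI[of _ "{..<m} - {j}"] exI[of _ "\<lambda>l. ?s * c l"] exI[of _ \<rho>]) auto
    then show False using min[OF jm] by blast
  qed
  then have "gpieceZ (syz m \<rho>) 0 = {0}"
    using submodule_syz[of m \<rho>] by (auto simp: gpieceZ_def submodule_def)
  then show ?thesis by (simp add: hilb_def cdim_def V.dim_zero)
qed

section \<open>Hilbert function of the Milnor algebra\<close>

lemma jac_piece_subset_forms: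
  assumes "homog d f"
  shows "jac_piece d f k \<subseteq> forms (int k)"
proof (cases "k + 1 < d")
  case False
  have *: "homogZ (int (k + 1 - d) + (int d - 1)) (a * dx f)" "homogZ (int (k + 1 - d) + (int d - 1)) (a * dy f)"
    "homogZ (int (k + 1 - d) + (int d - 1)) (a * dz f)" if "homogZ (int (k + 1 - d)) a" for a
    using that homogZ_deriv[of "int d" f] assms by (auto simp: homog_iff_homogZ intro!: homogZ_mult)
  have "int (k + 1 - d) + (int d - 1) = int k" using False by simp
  note * = *[unfolded this]
  show ?thesis using False * by (auto simp: jac_piece_def forms_def homog_iff_homogZ intro!: homogZ_add)
qed (auto simp: jac_piece_def forms_def)

lemma pdim_jac_piece_le: "homog d f \<Longrightarrow> int (pdim (jac_piece d f k)) \<le> sdim (int k)"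
proof -
  assume f: "homog d f"
  obtain F where F: "finite F" "forms (int k) \<subseteq> P.span F" by (rule finite_span_forms)
  show ?thesis
    using P.dim_mono_finite[OF jac_piece_subset_forms[OF f] F(2,1)] by (simp add: sdim_def pdim_def)
qed

lemma linear_mult: "Vector_Spaces.linear cscale cscale (\<lambda>p. g * p)"
  by (simp add: Vector_Spaces.linear_iff P.vector_space_axioms cscale_def algebra_simps)

lemma pdim_mult_forms:
  assumes "g \<noteq> 0"
  shows "int (pdim ((\<lambda>p. g * p) ` forms k)) = sdim k"
proof -
  obtain F where F: "finite F" "forms k \<subseteq> P.span F" by (rule finite_span_forms)
  show ?thesis
    using PP.dim_inj_image[OF linear_mult subspace_forms F(2,1), of g] assms by (simp add: sdim_def pdim_def)
qed

text \<open>The Jacobian ideal contains \<open>g S_k + h S_k\<close> for the coprime forms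
  \<open>g\<close>, \<open>h\<close> of degree \<open>d - 1\<close>. By coprimality the two summands
  meet only in multiples of \<open>g * h\<close>, and Grassmann's formula gives the bound.\<close>

lemma pdim_jac_piece_ge:
  assumes f: "reduced f" "homog d f" "d > 0"
  shows "2 * sdim (int k) - sdim (int k - (int d - 1)) \<le> int (pdim (jac_piece d f (k + (d - 1))))"
proof -
  obtain g t where g: "g \<in> {dx f, dy f, dz f}" "g \<noteq> 0"
    and h0: "dx f + cscale t (dy f) + cscale (t * t) (dz f) \<noteq> 0"
    and cop0: "\<And>a b. g * a = (dx f + cscale t (dy f) + cscale (t * t) (dz f)) * b \<Longrightarrow>
       (dx f + cscale t (dy f) + cscale (t * t) (dz f)) dvd a"
    by (rule ex_coprime_in_jacobian[OF f]) blast
  define h where "h = dx f + cscale t (dy f) + cscale (t * t) (dz f)"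
  note h0 = h0[folded h_def] and cop = cop0[folded h_def]
  let ?n = "int d - 1" and ?k = "int k" and ?J = "jac_piece d f (k + (d - 1))"
  have hom: "homogZ ?n (dx f)" "homogZ ?n (dy f)" "homogZ ?n (dz f)"
    using homogZ_deriv f(2) by (simp_all add: homog_iff_homogZ)
  then have hg: "homogZ ?n g" and hh: "homogZ ?n h"
    using g by (auto simp: h_def intro!: homogZ_add homogZ_cscale)
  let ?G = "(\<lambda>p. g * p) ` forms ?k" and ?H = "(\<lambda>p. h * p) ` forms ?k"
  obtain F where F: "finite F" "forms (?n + ?k) \<subseteq> P.span F" by (rule finite_span_forms)
  have GH: "?G \<subseteq> forms (?n + ?k)" "?H \<subseteq> forms (?n + ?k)"
    using hg hh by (auto simp: forms_def homogZ_mult)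
  have sub: "P.subspace ?G" "P.subspace ?H"
    by (rule PP.linear_subspace_image[OF linear_mult subspace_forms])+
  have "?G \<inter> ?H \<subseteq> (\<lambda>p. (g * h) * p) ` forms (?k - ?n)"
  proof
    fix v assume "v \<in> ?G \<inter> ?H"
    then obtain a b where v: "v = g * a" "a \<in> forms ?k" "v = h * b" by blast
    then obtain c where c: "a = h * c" using cop by (metis dvdE)
    \<comment> \<open>The cofactor \<open>c\<close> need not be homogeneous; its component of degree
      \<open>?k - ?n\<close> already yields \<open>a\<close>.\<close>
    have "a = hom_part (?k - ?n + ?n) (c * h)"
      using hom_part_homogZ[of ?k a ?k] v(2) by (simp add: c forms_def mult.commute)
    then have "a = h * hom_part (?k - ?n) c" by (simp only: hom_part_mult_homogZ[OF hh] mult.commute)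
    then have "v = g * h * hom_part (?k - ?n) c" using v(1) by (simp add: mult.assoc)
    then show "v \<in> (\<lambda>p. (g * h) * p) ` forms (?k - ?n)" using homogZ_hom_part by (auto simp: forms_def)
  qed
  moreover have "homogZ (?n + ?k) (g * h * p)" if "homogZ (?k - ?n) p" for p
    using homogZ_mult[OF homogZ_mult[OF hg hh] that] by (simp add: algebra_simps)
  then have "(\<lambda>p. (g * h) * p) ` forms (?k - ?n) \<subseteq> forms (?n + ?k)" by (auto simp: forms_def)
  ultimately have "pdim (?G \<inter> ?H) \<le> pdim ((\<lambda>p. (g * h) * p) ` forms (?k - ?n))"
    unfolding pdim_def using F by (intro P.dim_mono_finite) auto
  then have "int (pdim (?G \<inter> ?H)) \<le> sdim (?k - ?n)"
    using pdim_mult_forms[of "g * h" "?k - ?n"] g h0 by simp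
  moreover have "pdim {x + y |x y. x \<in> ?G \<and> y \<in> ?H} + pdim (?G \<inter> ?H) = pdim ?G + pdim ?H"
    unfolding pdim_def using GH F by (intro P.dim_sum_Int[OF sub(1) _ sub(2)]) auto
  moreover have "pdim {x + y |x y. x \<in> ?G \<and> y \<in> ?H} \<le> pdim ?J"
  proof -
    have J: "?J = {a * dx f + b * dy f + c * dz f | a b c. homogZ ?k a \<and> homogZ ?k b \<and> homogZ ?k c}"
      using f(3) by (auto simp: jac_piece_def homog_iff_homogZ)
    have "g * p + h * q \<in> ?J" if pq: "homogZ ?k p" "homogZ ?k q" for p q
    proof -
      have *: "h * q = q * dx f + cscale t q * dy f + cscale (t * t) q * dz f"
        by (simp add: h_def cscale_def algebra_simps)
      consider "g = dx f" | "g = dy f" | "g = dz f" using g by blast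
      then show ?thesis
      proof cases
        case 1
        have "g * p + h * q = (p + q) * dx f + cscale t q * dy f + cscale (t * t) q * dz f"
          by (simp add: * 1 algebra_simps)
        then show ?thesis unfolding J using pq homogZ_add homogZ_cscale by blast
      next
        case 2
        have "g * p + h * q = q * dx f + (p + cscale t q) * dy f + cscale (t * t) q * dz f"
          by (simp add: * 2 algebra_simps)
        then show ?thesis unfolding J using pq homogZ_add homogZ_cscale by blast
      next
        case 3
        have "g * p + h * q = q * dx f + cscale t q * dy f + (p + cscale (t * t) q) * dz f"
          by (simp add: * 3 algebra_simps)
        then show ?thesis unfolding J using pq homogZ_add homogZ_cscale by blast
      qed
    qed
    then have "{x + y |x y. x \<in> ?G \<and> y \<in> ?H} \<subseteq> ?J" by (auto simp: forms_def)
    moreover have "?J \<subseteq> P.span F"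
      using jac_piece_subset_forms[OF f(2), of "k + (d - 1)"] F(2) f(3) by (simp add: algebra_simps)
    ultimately show ?thesis unfolding pdim_def using F(1) by (rule P.dim_mono_finite)
  qed
  ultimately show ?thesis
    using pdim_mult_forms[OF g(2), of ?k] pdim_mult_forms[OF h0, of ?k] by linarith
qed

definition milnor_hilb :: "nat \<Rightarrow> poly3 \<Rightarrow> nat \<Rightarrow> int" where
  "milnor_hilb d f k = sdim (int k) - int (pdim (jac_piece d f k))"

text \<open>The upper bound is the Bezout number of two coprime forms of degree
  \<open>d - 1\<close>. The restriction on \<open>k\<close> puts every degree involved in the range
  of \<open>sdim_eq\<close>.\<close>

lemma milnor_hilb_bounds:
  assumes f: "reduced f" "homog d f" "d > 0" and k: "k \<ge> 2 * (d - 1)"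
  shows "0 \<le> milnor_hilb d f k" "milnor_hilb d f k \<le> (int d - 1)\<^sup>2"
proof -
  show "0 \<le> milnor_hilb d f k" using pdim_jac_piece_le[OF f(2)] by (simp add: milnor_hilb_def)
  define l where "l = k - (d - 1)"
  then have kl: "k = l + (d - 1)" "d - 1 \<le> l" using k by auto
  have "milnor_hilb d f k \<le> sdim (int k) - (2 * sdim (int l) - sdim (int l - (int d - 1)))"
    using pdim_jac_piece_ge[OF f, of l] kl by (simp add: milnor_hilb_def)
  moreover have "2 * sdim (int k) = (int l + int d) * (int l + int d + 1)"
    using sdim_eq[of "int k"] kl f(3) by (simp add: algebra_simps of_nat_diff)
  moreover have "2 * sdim (int l) = (int l + 1) * (int l + 2)" by (rule sdim_eq) simp
  moreover have "2 * sdim (int l - (int d - 1)) = (int l - int d + 2) * (int l - int d + 3)"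
    using sdim_eq[of "int l - (int d - 1)"] kl f(3) by (simp add: algebra_simps)
  ultimately show "milnor_hilb d f k \<le> (int d - 1)\<^sup>2"
    by (simp add: algebra_simps power2_eq_square)
qed

section \<open>Recovering the generator degrees from the Hilbert function\<close>

lemma bounded_linear_sequence:
  fixes u :: "nat \<Rightarrow> int"
  assumes step: "\<And>n. u (Suc n) - u n = c" and bound: "\<And>n. \<bar>u n\<bar> \<le> M"
  shows "c = 0"
proof (rule ccontr)
  assume "c \<noteq> 0"
  have u: "u n = u 0 + c * int n" for n
    by (induction n) (use step in \<open>auto simp: algebra_simps eq_diff_eq\<close>)
  have "0 \<le> M" using bound[of 0] by linarith
  \<comment> \<open>After this many steps the sequence has moved by more than \<open>2 * M\<close>,
    the largest possible distance of two of its values.\<close>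
  define n where "n = nat (2 * M + 1)"
  have "int n = 2 * M + 1" using \<open>0 \<le> M\<close> by (simp add: n_def)
  have "\<bar>c * int n\<bar> \<le> 2 * M" using u[of n] bound[of 0] bound[of n] by linarith
  moreover have "1 * int n \<le> \<bar>c\<bar> * int n" using \<open>c \<noteq> 0\<close> by (intro mult_right_mono) auto
  then have "int n \<le> \<bar>c * int n\<bar>" by (simp add: abs_mult)
  ultimately show False using \<open>int n = 2 * M + 1\<close> by linarith
qed

text \<open>Boundedness passes to the first differences, so the linear case applies to these and
  then to \<open>u\<close> itself.\<close>

lemma bounded_quadratic_sequence:
  fixes u :: "nat \<Rightarrow> int"
  assumes step: "\<And>n. u (Suc (Suc n)) - 2 * u (Suc n) + u n = e" and bound: "\<And>n. \<bar>u n\<bar> \<le> M"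
  shows "e = 0" "u n = u 0"
proof -
  have "\<bar>u (Suc n) - u n\<bar> \<le> 2 * M" for n using bound[of n] bound[of "Suc n"] by linarith
  then show e: "e = 0"
    by (rule bounded_linear_sequence[of "\<lambda>n. u (Suc n) - u n" e, rotated])
      (use step in \<open>simp add: algebra_simps\<close>)
  have lin: "u (Suc n) - u n = u 1 - u 0" for n
  proof (induction n)
    case (Suc n)
    then show ?case using step[of n] e by linarith
  qed simp
  have "u 1 - u 0 = 0" by (rule bounded_linear_sequence[of u, OF lin bound])
  then have "u (Suc n) = u n" for n using lin[of n] by simp
  then show "u n = u 0" by (induction n) simp_all
qed

text \<open>Summation by parts: as \<open>H\<close> vanishes in negative degrees, the moments of its
  third difference are expressed by the values of \<open>H\<close> at the upper end.\<close>

lemma moments_of_third_difference: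
  fixes H :: "int \<Rightarrow> int" and \<beta> :: "nat \<Rightarrow> nat"
  assumes \<beta>: "\<And>n. int (\<beta> n) = H n - 3 * H (int n - 1) + 3 * H (int n - 2) - H (int n - 3)"
    and neg: "\<And>k. k < 0 \<Longrightarrow> H k = 0"
  shows "(\<Sum>j\<le>n. int (\<beta> j)) = H n - 2 * H (int n - 1) + H (int n - 2)"
    and "(\<Sum>j\<le>n. int j * int (\<beta> j)) = int n * (H n - 2 * H (int n - 1) + H (int n - 2)) - (H (int n - 1) - H (int n - 2))"
    and "(\<Sum>j\<le>n. int j * int j * int (\<beta> j)) = int n * int n * (H n - 2 * H (int n - 1) + H (int n - 2))
      - (2 * int n - 1) * (H (int n - 1) - H (int n - 2)) + 2 * H (int n - 2)"
  by (induction n; simp add: \<beta> neg; simp add: algebra_simps)+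

text \<open>\<open>H\<close> is a quadratic polynomial minus a shift of \<open>t\<close>, so the
  partial sums of \<open>\<beta>\<close> are \<open>m - 2\<close> minus a second difference of
  \<open>t\<close>. They are nondecreasing and bounded, hence eventually constant; then
  \<open>t\<close> is bounded with eventually constant second difference, hence eventually constant.
  Inserting its final value into the moment formulas gives the three sums. In the application
  \<open>A = d - 1\<close>.\<close>

lemma eventually_constant_colength:
  fixes H :: "int \<Rightarrow> int" and \<beta> :: "nat \<Rightarrow> nat" and t :: "nat \<Rightarrow> int" and m r A :: nat
  assumes \<beta>: "\<And>n. int (\<beta> n) = H n - 3 * H (int n - 1) + 3 * H (int n - 2) - H (int n - 3)"
    and neg: "\<And>k. k < 0 \<Longrightarrow> H k = 0"
    and H: "\<And>k. 2 * H (int k) = int m * ((int k + 1) * (int k + 2))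
       - 3 * ((int k + int r + 1) * (int k + int r + 2))
       + (int k + int r + int A + 1) * (int k + int r + int A + 2) - 2 * t (k + r + A)"
    and bound: "\<And>k. k \<ge> K \<Longrightarrow> 0 \<le> t k \<and> t k \<le> M"
    and m: "int m = 2 * int r - int A"
  obtains J \<tau> where "\<And>k. k \<ge> J \<Longrightarrow> t k = \<tau>"
    "\<And>n. n \<ge> J \<Longrightarrow> (\<Sum>j\<le>n. int (\<beta> j)) = int m - 2"
    "\<And>n. n \<ge> J \<Longrightarrow> (\<Sum>j\<le>n. int j * int (\<beta> j)) = int m"
    "\<And>n. n \<ge> J \<Longrightarrow> (\<Sum>j\<le>n. int j * int j * int (\<beta> j)) =
      - int m - 3 * int r * (int r - 1) + (int r + int A) * (int r + int A - 1) - 2 * \<tau>"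
proof -
  note mom = moments_of_third_difference[where H = H and \<beta> = \<beta>, OF \<beta> neg]
  have H0: "2 * H (int n) = int m * ((int n + 1) * (int n + 2))
       - 3 * ((int n + int r + 1) * (int n + int r + 2))
       + (int n + int r + int A + 1) * (int n + int r + int A + 2) - 2 * t (n + r + A)"
    and H1: "2 * H (int n - 1) = int m * (int n * (int n + 1))
       - 3 * ((int n + int r) * (int n + int r + 1))
       + (int n + int r + int A) * (int n + int r + int A + 1) - 2 * t (n + r + A - 1)"
    and H2: "2 * H (int n - 2) = int m * ((int n - 1) * int n)
       - 3 * ((int n + int r - 1) * (int n + int r))
       + (int n + int r + int A - 1) * (int n + int r + int A) - 2 * t (n + r + A - 2)"
    if "n \<ge> 2" for n
  proof -
    obtain l where l: "n = l + 2" using \<open>n \<ge> 2\<close> by (metis add.commute le_Suc_ex)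
    have i: "int n = int l + 2" "int n - 1 = int (l + 1)" "int n - 2 = int l" "int n + 1 = int l + 3"
      "n + r + A - 1 = l + 1 + r + A" "n + r + A - 2 = l + r + A" by (auto simp: l)
    show "2 * H (int n) = int m * ((int n + 1) * (int n + 2))
       - 3 * ((int n + int r + 1) * (int n + int r + 2))
       + (int n + int r + int A + 1) * (int n + int r + int A + 2) - 2 * t (n + r + A)" by (rule H)
    show "2 * H (int n - 1) = int m * (int n * (int n + 1))
       - 3 * ((int n + int r) * (int n + int r + 1))
       + (int n + int r + int A) * (int n + int r + int A + 1) - 2 * t (n + r + A - 1)"
      unfolding i(2) H i(5) by (simp add: l algebra_simps)
    show "2 * H (int n - 2) = int m * ((int n - 1) * int n)
       - 3 * ((int n + int r - 1) * (int n + int r))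
       + (int n + int r + int A - 1) * (int n + int r + int A) - 2 * t (n + r + A - 2)"
      unfolding i(3) H i(6) by (simp add: l algebra_simps)
  qed
  have S: "(\<Sum>j\<le>n. int (\<beta> j)) = int m - 2 - (t (n + r + A) - 2 * t (n + r + A - 1) + t (n + r + A - 2))"
    if "n \<ge> 2" for n
    using mom(1)[of n] H0[OF that] H1[OF that] H2[OF that] by (simp add: algebra_simps)
  define S where "S n = (\<Sum>j\<le>n. \<beta> j)" for n
  have mono: "S i \<le> S j" if "i \<le> j" for i j unfolding S_def using that by (intro sum_mono2) auto
  have "S n \<le> nat (int m - 2 + 2 * M)" for n
  proof -
    \<comment> \<open>Far enough out for the bound to apply to all three values of \<open>t\<close>;
      monotonicity carries the estimate back to \<open>n\<close>.\<close>
    let ?n = "n + K + 2"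
    have "int (S ?n) \<le> int m - 2 + 2 * M"
      using S[of ?n] bound[of "?n + r + A"] bound[of "?n + r + A - 1"] bound[of "?n + r + A - 2"]
      by (simp add: S_def)
    then show ?thesis using mono[of n ?n] by linarith
  qed
  then have "finite (range S)" by (intro finite_subset[OF _ finite_atMost]) auto
  then have "Max (range S) \<in> range S" by (rule Max_in) auto
  then obtain J0 where J0: "S J0 = Max (range S)" by force
  have const: "S n = S J0" if "n \<ge> J0" for n
    using mono[OF that] Max_ge[OF \<open>finite (range S)\<close>, of "S n"] J0 by auto
  define J where "J = J0 + K + 2"
  have step: "t (J + r + A + Suc (Suc n)) - 2 * t (J + r + A + Suc n) + t (J + r + A + n) = int m - 2 - int (S J0)" for n
  proof -
    have idx: "J + r + A + Suc (Suc n) - 1 = J + r + A + Suc n" "J + r + A + Suc (Suc n) - 2 = J + r + A + n"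
      "n + J + 2 + r + A = J + r + A + Suc (Suc n)" by auto
    have "S (n + J + 2) = S J0" by (rule const) (simp add: J_def)
    then have "(\<Sum>j\<le>n + J + 2. int (\<beta> j)) = int (S J0)" by (simp only: S_def flip: of_nat_sum)
    moreover have "2 \<le> n + J + 2" by simp
    ultimately show ?thesis using S[of "n + J + 2"] unfolding idx by linarith
  qed
  have bd: "\<bar>t (J + r + A + n)\<bar> \<le> M" for n using bound[of "J + r + A + n"] by (simp add: J_def)
  have e0: "int m - 2 - int (S J0) = 0" and tc: "t (J + r + A + n) = t (J + r + A)" for n
    using bounded_quadratic_sequence[of "\<lambda>n. t (J + r + A + n)", OF step bd] by simp_all
  define \<tau> where "\<tau> = t (J + r + A)"
  have t\<tau>: "t k = \<tau>" if "k \<ge> J + r + A" for k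
    using tc[of "k - (J + r + A)"] that by (simp add: \<tau>_def)
  show ?thesis
  \<comment> \<open>The summand 2 covers the two backward shifts of \<open>t\<close>.\<close>
  proof (rule that[of "J + r + A + 2" \<tau>])
    show "t k = \<tau>" if "k \<ge> J + r + A + 2" for k using t\<tau> that by simp
    fix n assume n: "n \<ge> J + r + A + 2"
    then have n2: "n \<ge> 2" by simp
    have tn: "t (n + r + A) = \<tau>" "t (n + r + A - 1) = \<tau>" "t (n + r + A - 2) = \<tau>" using n by (auto intro!: t\<tau>)
    note h = H0[OF n2, unfolded tn] H1[OF n2, unfolded tn] H2[OF n2, unfolded tn]
    show "(\<Sum>j\<le>n. int (\<beta> j)) = int m - 2" using S[OF n2] tn by simp
    have d2: "H (int n) - 2 * H (int n - 1) + H (int n - 2) = int m - 2"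
      using h by (simp add: algebra_simps)
    have d1: "H (int n - 1) - H (int n - 2) = (int m - 2) * int n - (2 * int r - int A)"
      using h by (simp add: algebra_simps)
    \<comment> \<open>The excess hypothesis enters here: the first moment
      \<open>2 * int r - int A\<close> becomes \<open>int m\<close>.\<close>
    note d1 = d1[folded m]
    show "(\<Sum>j\<le>n. int j * int (\<beta> j)) = int m"
      using mom(2)[of n] unfolding d1 d2 by (simp add: algebra_simps)
    show "(\<Sum>j\<le>n. int j * int j * int (\<beta> j)) =
      - int m - 3 * int r * (int r - 1) + (int r + int A) * (int r + int A - 1) - 2 * \<tau>"
      using mom(3)[of n] unfolding d1 d2 h(3) by (simp add: m algebra_simps)
  qed
qed

text \<open>With \<open>\<beta> 0 = 0\<close> every term \<open>(j - 1) * \<beta> j\<close> is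
  nonnegative, and the total is 2, while a generator of degree at least 4 would contribute at least
  3. What remains is \<open>\<beta> 2 + 2 * \<beta> 3 = 2\<close>, that is, the partitions of
  2.\<close>

lemma excess_two_cases:
  fixes \<beta> :: "nat \<Rightarrow> nat" and m :: int
  assumes "\<beta> 0 = 0"
    and s0: "\<And>n. n \<ge> J \<Longrightarrow> (\<Sum>j\<le>n. int (\<beta> j)) = m - 2"
    and s1: "\<And>n. n \<ge> J \<Longrightarrow> (\<Sum>j\<le>n. int j * int (\<beta> j)) = m"
    and s2: "\<And>n. n \<ge> J \<Longrightarrow> (\<Sum>j\<le>n. int j * int j * int (\<beta> j)) = q"
  shows "(\<forall>k. int (\<beta> k) = (if k = 1 then m - 3 else if k = 3 then 1 else 0)) \<and> q = m + 6 \<or>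
    (\<forall>k. int (\<beta> k) = (if k = 1 then m - 4 else if k = 2 then 2 else 0)) \<and> q = m + 4"
proof -
  have excess: "(\<Sum>j\<le>n. (int j - 1) * int (\<beta> j)) = 2" if "n \<ge> J" for n
    using s0[OF that] s1[OF that] by (simp add: left_diff_distrib sum_subtractf)
  have nonneg: "0 \<le> (int j - 1) * int (\<beta> j)" for j using assms(1) by (cases j) auto
  have "\<beta> k = 0" if "k \<ge> 4" for k
  proof -
    have "(int k - 1) * int (\<beta> k) \<le> (\<Sum>j\<le>k + J. (int j - 1) * int (\<beta> j))"
      using nonneg by (intro member_le_sum) auto
    then have "(int k - 1) * int (\<beta> k) \<le> 2" using excess[of "k + J"] by simp
    moreover have "3 * int (\<beta> k) \<le> (int k - 1) * int (\<beta> k)" using that by (intro mult_right_mono) auto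
    ultimately show ?thesis by linarith
  qed
  \<comment> \<open>The upper end \<open>3 + J\<close> is beyond the threshold \<open>J\<close> and
    includes all indices up to 3.\<close>
  then have red: "(\<Sum>j\<le>3 + J. g j * int (\<beta> j)) = (\<Sum>j\<le>3. g j * int (\<beta> j))" for g
    by (intro sum.mono_neutral_right) auto
  have four: "(\<Sum>j\<le>3. g j * int (\<beta> j)) = g 1 * int (\<beta> 1) + g 2 * int (\<beta> 2) + g 3 * int (\<beta> 3)" for g
    using assms(1) by (simp add: numeral_3_eq_3 numeral_2_eq_2)
  have e: "int (\<beta> 1) + int (\<beta> 2) + int (\<beta> 3) = m - 2" "int (\<beta> 1) + 2 * int (\<beta> 2) + 3 * int (\<beta> 3) = m"
    "int (\<beta> 1) + 4 * int (\<beta> 2) + 9 * int (\<beta> 3) = q"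
    using s0[of "3 + J"] s1[of "3 + J"] s2[of "3 + J"] red[of "\<lambda>_. 1"] red[of int] red[of "\<lambda>j. int j * int j"]
      four[of "\<lambda>_. 1"] four[of int] four[of "\<lambda>j. int j * int j"] by simp_all
  then have "\<beta> 2 + 2 * \<beta> 3 = 2" by linarith
  then have c: "\<beta> 2 = 0 \<and> \<beta> 3 = 1 \<or> \<beta> 2 = 2 \<and> \<beta> 3 = 0" by presburger
  have ks: "k = 0 \<or> k = 1 \<or> k = 2 \<or> k = 3 \<or> k \<ge> 4" for k :: nat by linarith
  from c show ?thesis
  proof
    assume *: "\<beta> 2 = 0 \<and> \<beta> 3 = 1"
    then have "int (\<beta> k) = (if k = 1 then m - 3 else if k = 3 then 1 else 0)" for k
      using ks[of k] e(1) assms(1) \<open>\<And>k. k \<ge> 4 \<Longrightarrow> \<beta> k = 0\<close> by auto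
    then show ?thesis using * e by auto
  next
    assume *: "\<beta> 2 = 2 \<and> \<beta> 3 = 0"
    then have "int (\<beta> k) = (if k = 1 then m - 4 else if k = 2 then 2 else 0)" for k
      using ks[of k] e(1) assms(1) \<open>\<And>k. k \<ge> 4 \<Longrightarrow> \<beta> k = 0\<close> by auto
    then show ?thesis using * e by auto
  qed
qed

text \<open>The subtraction in \<open>tjurina\<close> is exact because the Jacobian piece lies in
  the space of forms, and two eventual values agree in any sufficiently large degree.\<close>

lemma tjurina_eq:
  assumes "homog d f" and "\<And>k. k \<ge> J \<Longrightarrow> milnor_hilb d f k = \<tau>"
  shows "int (tjurina d f) = \<tau>"
proof -
  have eq: "int (pdim {p. homog k p} - pdim (jac_piece d f k)) = milnor_hilb d f k" for k
    using pdim_jac_piece_le[OF assms(1), of k]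
    by (simp add: milnor_hilb_def sdim_def forms_def homog_iff_homogZ of_nat_diff)
  have "tjurina d f = nat \<tau>"
    unfolding tjurina_def
  proof (rule the_equality)
    show "\<exists>K. \<forall>k\<ge>K. pdim {p. homog k p} - pdim (jac_piece d f k) = nat \<tau>"
      using eq assms(2) by (metis nat_int)
    fix t assume "\<exists>K. \<forall>k\<ge>K. pdim {p. homog k p} - pdim (jac_piece d f k) = t"
    then obtain K where "\<forall>k\<ge>K. pdim {p. homog k p} - pdim (jac_piece d f k) = t" by blast
    then show "t = nat \<tau>"
      using eq[of "max K J"] assms(2)[of "max K J"] by (metis max.cobounded1 max.cobounded2 nat_int)
  qed
  moreover have "0 \<le> \<tau>" using eq[of J] assms(2)[of J] by (metis of_nat_0_le_iff order_refl)
  ultimately show ?thesis by simp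
qed

text \<open>A summand \<open>S(-e_j)\<close> with \<open>e_j = d + r - 1 + \<epsilon>_j\<close> is a
  minimal generator of the syzygy module with coefficients of degree \<open>\<epsilon>_j\<close>; so
  \<open>num_gens (syz m \<rho>) k\<close> counts the \<open>j\<close> with
  \<open>\<epsilon>_j = k\<close>.\<close>

theorem theorem3p3:
  fixes f :: poly3 and d r m :: nat and \<rho> :: "nat \<Rightarrow> vec3"
  assumes "d \<ge> 3" and "homog d f" and "reduced f"
    and "\<not> lines_through_point d f"
    and "min_gen_system f r m \<rho>"
    and "m > 3"
    and "(2 * int r - int d + 3) - int m = 2"
  shows "((\<forall>k. num_gens (syz m \<rho>) k =
              (if k = 1 then m - 3 else if k = 3 then 1 else 0)) \<and>
          int (tjurina d f) = int d * (int d - 1) div 2 - 3 + int r * (int d - int r - 2))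
       \<or> ((\<forall>k. num_gens (syz m \<rho>) k =
              (if k = 1 then m - 4 else if k = 2 then 2 else 0)) \<and>
          int (tjurina d f) = int d * (int d - 1) div 2 - 2 + int r * (int d - int r - 2))"
proof -
  have gen: "submod_gen (\<rho> ` {..<m}) = D0 f"
    and \<rho>D: "\<And>j. j < m \<Longrightarrow> \<rho> j \<in> D0 f"
    and \<rho>h: "\<And>j i. j < m \<Longrightarrow> homogZ (int r) (\<rho> j i)"
    and min: "\<And>j. j < m \<Longrightarrow> \<rho> j \<notin> submod_gen (\<rho> ` ({..<m} - {j}))"
    using assms(5) by (auto simp: min_gen_system_def gpiece_def homog_iff_homogZ)
  have d: "d > 0" using assms(1) by simp
  define A where "A = d - 1"
  have A: "int A = int d - 1" using d by (simp add: A_def)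
  have m: "int m = 2 * int r - int A" using assms(7) A by simp
  let ?H = "hilb (syz m \<rho>)" and ?\<beta> = "num_gens (syz m \<rho>)" and ?t = "milnor_hilb d f"
  have H: "2 * ?H (int k) = int m * ((int k + 1) * (int k + 2))
       - 3 * ((int k + int r + 1) * (int k + int r + 2))
       + (int k + int r + int A + 1) * (int k + int r + int A + 2) - 2 * ?t (k + r + A)" for k
  proof -
    have "?H (int k) + hilb (D0 f) (int (k + r)) = int m * sdim (int k)"
      using hilb_syz[OF gen \<rho>h \<rho>D] by simp
    moreover have "hilb (D0 f) (int (k + r)) + int (pdim (jac_piece d f (k + r + A))) = 3 * sdim (int (k + r))"
      unfolding A_def by (rule hilb_D0[OF d])
    moreover have "2 * sdim (int k) = (int k + 1) * (int k + 2)" by (rule sdim_eq) simp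
    then have "2 * (int m * sdim (int k)) = int m * ((int k + 1) * (int k + 2))" by (metis mult.left_commute)
    moreover have "2 * sdim (int (k + r)) = (int k + int r + 1) * (int k + int r + 2)"
      using sdim_eq[of "int (k + r)"] by simp
    moreover have "2 * sdim (int (k + r + A)) = (int k + int r + int A + 1) * (int k + int r + int A + 2)"
      using sdim_eq[of "int (k + r + A)"] by simp
    \<comment> \<open>Naming the nonlinear products \<open>X\<close>, \<open>Y\<close>,
      \<open>Z\<close> turns the elimination of \<open>hilb (D0 f)\<close> into linear
      arithmetic.\<close>
    moreover have "2 * h = X - 3 * Y + Z - 2 * (s - j)"
      if "h + h' = u" "h' + j = 3 * s'" "2 * u = X" "2 * s' = Y" "2 * s = Z" for h h' u j s s' X Y Z :: int
      using that by presburger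
    ultimately show ?thesis unfolding milnor_hilb_def by blast
  qed
  have \<beta>: "int (?\<beta> n) = ?H n - 3 * ?H (int n - 1) + 3 * ?H (int n - 2) - ?H (int n - 3)" for n
    by (rule num_gens_syz[OF gen \<rho>h \<rho>D])
  have neg: "?H k = 0" if "k < 0" for k using hilb_neg[OF submodule_syz that] .
  have bound: "0 \<le> ?t k \<and> ?t k \<le> (int d - 1)\<^sup>2" if "k \<ge> 2 * (d - 1)" for k
    using milnor_hilb_bounds[OF assms(3,2) d that] by blast
  obtain J \<tau> where \<tau>: "\<And>k. k \<ge> J \<Longrightarrow> ?t k = \<tau>"
    and s: "\<And>n. n \<ge> J \<Longrightarrow> (\<Sum>j\<le>n. int (?\<beta> j)) = int m - 2"
    "\<And>n. n \<ge> J \<Longrightarrow> (\<Sum>j\<le>n. int j * int (?\<beta> j)) = int m"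
    "\<And>n. n \<ge> J \<Longrightarrow> (\<Sum>j\<le>n. int j * int j * int (?\<beta> j)) =
      - int m - 3 * int r * (int r - 1) + (int r + int A) * (int r + int A - 1) - 2 * \<tau>"
    using eventually_constant_colength[OF \<beta> neg H bound m] by blast
  \<comment> \<open>In degree 0 the third difference is \<open>?H 0\<close> alone.\<close>
  have "?\<beta> 0 = 0" using \<beta>[of 0] neg hilb_syz_0[OF min] by simp
  note cases = excess_two_cases[OF this s]
  have tj: "int (tjurina d f) = \<tau>" by (rule tjurina_eq[OF assms(2) \<tau>])
  \<comment> \<open>\<open>d (d - 1)\<close> is even, so the division is exact and the values of
    \<open>\<tau>\<close> can be compared after doubling.\<close>
  have half: "2 * (int d * (int d - 1) div 2) = int d * (int d - 1)"
    by (rule dvd_mult_div_cancel) simp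
  have A2: "(int r + int A) * (int r + int A - 1) = (int r + int d - 1) * (int r + int d - 2)"
    by (simp add: A algebra_simps)
  from cases show ?thesis
  proof
    assume *: "(\<forall>k. int (?\<beta> k) = (if k = 1 then int m - 3 else if k = 3 then 1 else 0)) \<and>
      - int m - 3 * int r * (int r - 1) + (int r + int A) * (int r + int A - 1) - 2 * \<tau> = int m + 6"
    \<comment> \<open>\<open>m > 3\<close> makes the subtraction on naturals agree with the integer
      one.\<close>
    have "?\<beta> k = (if k = 1 then m - 3 else if k = 3 then 1 else 0)" for k
      using *[THEN conjunct1, rule_format, of k] assms(6) by (auto split: if_splits)
    \<comment> \<open>The second moment, with \<open>m = 2 * r - d + 1\<close> substituted, is
      solved for \<open>\<tau>\<close>.\<close>
    moreover have "2 * \<tau> = 2 * (int d * (int d - 1) div 2 - 3 + int r * (int d - int r - 2))"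
      using conjunct2[OF *] half m A unfolding A2 by (simp add: algebra_simps)
    ultimately show ?thesis using tj by auto
  next
    assume *: "(\<forall>k. int (?\<beta> k) = (if k = 1 then int m - 4 else if k = 2 then 2 else 0)) \<and>
      - int m - 3 * int r * (int r - 1) + (int r + int A) * (int r + int A - 1) - 2 * \<tau> = int m + 4"
    have "?\<beta> k = (if k = 1 then m - 4 else if k = 2 then 2 else 0)" for k
      using *[THEN conjunct1, rule_format, of k] assms(6) by (auto split: if_splits)
    moreover have "2 * \<tau> = 2 * (int d * (int d - 1) div 2 - 2 + int r * (int d - int r - 2))"
      using conjunct2[OF *] half m A unfolding A2 by (simp add: algebra_simps)
    ultimately show ?thesis using tj by auto
  qed
qed

end
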